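(* Let $G$ be a group with a finite generating set $A$, $A^{-1}=A$, and with an automatic structure $(A, W, \{M_x\}_{x\in A\cup\{\varepsilon\}})$ which is weakly geodesically automatic, prefix closed and has the uniqueness property. If $G$ is not word hyperbolic, then for every integer $n>0$ the Cayley graph $\Gamma(G,A)$ contains $n$-tracks of length $n$ (with respect to this automatic structure).
   Context: Cayley graph: $\Gamma=\Gamma(G,A)$ has vertex set $G$, with a directed edge labelled $a\in A$ from $g$ to $h$ if and only if $ga=h$; it carries the path metric $d$. The identity of $G$ is denoted $\varepsilon$. The group $G$ is word hyperbolic if $\Gamma$ is a hyperbolic geodesic space in the sense of Gromov (there is $\delta>0$ such that in each geodesic triangle every point of one side is within $\delta$ of the union of the other two sides). Words: for a word $w$ over $A$, $\ell(w)$ is its length, $w(t)$ is its prefix of length $t$, and $\overline{w}$ is its image in $G$. The expression $\overline{w(t_1,t_2)}$ denotes the subpath, from the vertex $\overline{w(t_1)}$ to the vertex $\overline{w(t_2)}$, of the path in $\Gamma$ starting at the identity vertex and labelled by $w$. Automatic structure: let $\$\notin A$ be a padding letter. An automatic structure on $G$ consists of a finite state automaton $W$ over $A$ (the word acceptor) and finite state automata $M_x$ over $(A\cup\{\$\})\times(A\cup\{\$\})$, $x\in A\cup\{\varepsilon\}$ (the compare automata), such that (1) the natural projection from the accepted language $L(W)$ to $G$ is surjective; (2) for each $x\in A\cup\{\varepsilon\}$, a pair $(w,w')$ is accepted by $M_x$ if and only if $\overline{wx}=\overline{w'}$ and both $w,w'\in L(W)$. A pair $(w,w')$ is read letter by letter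 as a string of pairs, the shorter word being padded at its end with $\$$. The structure is prefix closed if every prefix of every word in $L(W)$ is in $L(W)$. It has the uniqueness property if the natural projection $L(W)\to G$ is injective (hence bijective). It is weakly geodesically automatic if every word in $L(W)$ is geodesic with respect to the path metric of $\Gamma$. $n$-tracks of length $n$: a set $T=\{t_1,\dots,t_n\}$ of mutually disjoint $n$ paths of length $n$ in $\Gamma$ is called $n$-tracks of length $n$ if there exist $2n$ words $w_1,w_1',w_2,w_2',\dots,w_n,w_n'$ in $L(W)$ and a positive integer $r$ such that $(w_i',w_{i+1})$ is accepted by some compare automaton for $i=1,\dots,n-1$, and $t_i=\overline{w_i(r,r+n)}=\overline{w_i'(r,r+n)}$ for $i=1,\dots,n$ (so all these words have length at least $r+n$). *)

theory Defs
  imports Complex_Main "HOL-Algebra.Generated_Groups"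
begin

section \<open>Words and the word metric\<close>

definition word_eval :: "('a, 'm) monoid_scheme \<Rightarrow> 'a list \<Rightarrow> 'a" where
  "word_eval G w = foldr (mult G) w (one G)"

text \<open>The path metric on the vertices of the Cayley graph: a path of length \<open>k\<close> from \<open>g\<close> to
  \<open>h\<close> is labelled by a word of length \<open>k\<close> over \<open>A\<close>. When \<open>A\<close> generates \<open>G\<close>
  and is closed under inverses, such a word exists for all \<open>g\<close> and \<open>h\<close>.\<close>

definition word_dist :: "('a, 'm) monoid_scheme \<Rightarrow> 'a set \<Rightarrow> 'a \<Rightarrow> 'a \<Rightarrow> nat" where
  "word_dist G A g h =
     (LEAST k. \<exists>w \<in> lists A. length w = k \<and> g \<otimes>\<^bsub>G\<^esub> word_eval G w = h)"

section \<open>The Cayley graph as a geodesic metric space\<close>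

text \<open>\<open>Inner g a s\<close>, with \<open>0 < s < 1\<close>, is the point at distance \<open>s\<close> from \<open>g\<close> along the edge
  labelled \<open>a\<close> from \<open>g\<close> to \<open>g \<otimes> a\<close>. Every pair \<open>(g, a)\<close> has its own edge of length 1; in
  particular the edge labelled \<open>a\<close> from \<open>g\<close> to \<open>h\<close> and the edge labelled \<open>inv a\<close>
  from \<open>h\<close> to \<open>g\<close> are not identified.\<close>

datatype 'a cayley_point = Vertex 'a | Inner 'a 'a real

definition cayley_points :: "('a, 'm) monoid_scheme \<Rightarrow> 'a set \<Rightarrow> 'a cayley_point set" where
  "cayley_points G A =
     Vertex ` carrier G \<union> {Inner g a s | g a s. g \<in> carrier G \<and> a \<in> A \<and> 0 < s \<and> s < 1}"

text \<open>The end vertices of the edge carrying a point, with the distances to them along the edge.\<close>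

fun point_ends :: "('a, 'm) monoid_scheme \<Rightarrow> 'a cayley_point \<Rightarrow> ('a \<times> real) set" where
  "point_ends G (Vertex g) = {(g, 0)}"
| "point_ends G (Inner g a s) = {(g, s), (g \<otimes>\<^bsub>G\<^esub> a, 1 - s)}"

text \<open>The length of the direct route between two points in the interior of the same edge.\<close>

fun edge_route :: "'a cayley_point \<Rightarrow> 'a cayley_point \<Rightarrow> real set" where
  "edge_route (Inner g a s) (Inner h b t) = (if g = h \<and> a = b then {\<bar>s - t\<bar>} else {})"
| "edge_route _ _ = {}"

definition cayley_dist ::
    "('a, 'm) monoid_scheme \<Rightarrow> 'a set \<Rightarrow> 'a cayley_point \<Rightarrow> 'a cayley_point \<Rightarrow> real" where
  "cayley_dist G A p q =
     Min ((\<lambda>((u, \<alpha>), (v, \<beta>)). \<alpha> + real (word_dist G A u v) + \<beta>)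
            ` (point_ends G p \<times> point_ends G q)
          \<union> edge_route p q)"

section \<open>Gromov hyperbolicity\<close>

definition geodesic_segment ::
    "'p set \<Rightarrow> ('p \<Rightarrow> 'p \<Rightarrow> real) \<Rightarrow> 'p \<Rightarrow> 'p \<Rightarrow> 'p set \<Rightarrow> bool" where
  "geodesic_segment X d x y S \<longleftrightarrow>
     (\<exists>L \<sigma>. 0 \<le> L \<and> \<sigma> 0 = x \<and> \<sigma> L = y \<and> S = \<sigma> ` {0..L} \<and> S \<subseteq> X \<and>
        (\<forall>s \<in> {0..L}. \<forall>t \<in> {0..L}. d (\<sigma> s) (\<sigma> t) = \<bar>s - t\<bar>))"

definition gromov_hyperbolic :: "'p set \<Rightarrow> ('p \<Rightarrow> 'p \<Rightarrow> real) \<Rightarrow> bool" where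
  "gromov_hyperbolic X d \<longleftrightarrow>
     (\<exists>\<delta>>0. \<forall>x y z S\<^sub>1 S\<^sub>2 S\<^sub>3.
        geodesic_segment X d x y S\<^sub>1 \<and> geodesic_segment X d y z S\<^sub>2 \<and>
        geodesic_segment X d z x S\<^sub>3 \<longrightarrow>
        (\<forall>p \<in> S\<^sub>1. \<exists>q \<in> S\<^sub>2 \<union> S\<^sub>3. d p q \<le> \<delta>))"

definition word_hyperbolic :: "('a, 'm) monoid_scheme \<Rightarrow> 'a set \<Rightarrow> bool" where
  "word_hyperbolic G A \<longleftrightarrow> gromov_hyperbolic (cayley_points G A) (cayley_dist G A)"

section \<open>Finite state automata\<close>

record ('q, 'l) fsa =
  fsa_states :: "'q set"
  fsa_start :: 'q
  fsa_final :: "'q set"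
  fsa_next :: "'q \<Rightarrow> 'l \<Rightarrow> 'q"

definition fsa_over :: "'l set \<Rightarrow> ('q, 'l) fsa \<Rightarrow> bool" where
  "fsa_over \<Sigma> D \<longleftrightarrow>
     finite (fsa_states D) \<and> fsa_start D \<in> fsa_states D \<and> fsa_final D \<subseteq> fsa_states D \<and>
     (\<forall>q \<in> fsa_states D. \<forall>x \<in> \<Sigma>. fsa_next D q x \<in> fsa_states D)"

definition fsa_lang :: "'l set \<Rightarrow> ('q, 'l) fsa \<Rightarrow> 'l list set" where
  "fsa_lang \<Sigma> D = {w \<in> lists \<Sigma>. foldl (fsa_next D) (fsa_start D) w \<in> fsa_final D}"

section \<open>Automatic structures\<close>

text \<open>The padding letter is \<open>None\<close>; a letter \<open>a\<close> of \<open>A\<close> is \<open>Some a\<close>.\<close>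

definition padded_alphabet :: "'a set \<Rightarrow> ('a option \<times> 'a option) set" where
  "padded_alphabet A = insert None (Some ` A) \<times> insert None (Some ` A)"

definition pad_pair :: "'a list \<Rightarrow> 'a list \<Rightarrow> ('a option \<times> 'a option) list" where
  "pad_pair w w' =
     zip (map Some w @ replicate (length w' - length w) None)
         (map Some w' @ replicate (length w - length w') None)"

definition accepts_pair ::
    "'a set \<Rightarrow> ('q, 'a option \<times> 'a option) fsa \<Rightarrow> 'a list \<Rightarrow> 'a list \<Rightarrow> bool" where
  "accepts_pair A D w w' \<longleftrightarrow> pad_pair w w' \<in> fsa_lang (padded_alphabet A) D"

definition automatic_structure ::
    "('a, 'm) monoid_scheme \<Rightarrow> 'a set \<Rightarrow> ('p, 'a) fsa
      \<Rightarrow> ('a \<Rightarrow> ('q, 'a option \<times> 'a option) fsa) \<Rightarrow> bool" where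
  "automatic_structure G A W M \<longleftrightarrow>
     fsa_over A W \<and>
     (\<forall>x \<in> A \<union> {\<one>\<^bsub>G\<^esub>}. fsa_over (padded_alphabet A) (M x)) \<and>
     word_eval G ` fsa_lang A W = carrier G \<and>
     (\<forall>x \<in> A \<union> {\<one>\<^bsub>G\<^esub>}. \<forall>w \<in> lists A. \<forall>w' \<in> lists A.
        accepts_pair A (M x) w w' \<longleftrightarrow>
          word_eval G w \<otimes>\<^bsub>G\<^esub> x = word_eval G w' \<and> w \<in> fsa_lang A W \<and> w' \<in> fsa_lang A W)"

definition prefix_closed :: "'a list set \<Rightarrow> bool" where
  "prefix_closed L \<longleftrightarrow> (\<forall>w \<in> L. \<forall>t \<le> length w. take t w \<in> L)"

definition uniqueness_property :: "('a, 'm) monoid_scheme \<Rightarrow> 'a list set \<Rightarrow> bool" where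
  "uniqueness_property G L \<longleftrightarrow> inj_on (word_eval G) L"

definition weakly_geodesic :: "('a, 'm) monoid_scheme \<Rightarrow> 'a set \<Rightarrow> 'a list set \<Rightarrow> bool" where
  "weakly_geodesic G A L \<longleftrightarrow>
     (\<forall>w \<in> L. word_dist G A \<one>\<^bsub>G\<^esub> (word_eval G w) = length w)"

section \<open>Tracks\<close>

text \<open>An edge path is given by its sequence of vertices, which determines its labels because
  \<open>g \<otimes> a = h\<close> determines \<open>a\<close>. Two edge paths between vertices are disjoint
  in the Cayley graph iff they have no vertex in common.\<close>

definition subpath :: "('a, 'm) monoid_scheme \<Rightarrow> 'a list \<Rightarrow> nat \<Rightarrow> nat \<Rightarrow> 'a list" where
  "subpath G w t\<^sub>1 t\<^sub>2 = map (\<lambda>t. word_eval G (take t w)) [t\<^sub>1..<Suc t\<^sub>2]"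

definition n_tracks ::
    "('a, 'm) monoid_scheme \<Rightarrow> 'a set \<Rightarrow> ('p, 'a) fsa
      \<Rightarrow> ('a \<Rightarrow> ('q, 'a option \<times> 'a option) fsa) \<Rightarrow> nat \<Rightarrow> 'a list set \<Rightarrow> bool" where
  "n_tracks G A W M n T \<longleftrightarrow>
     (\<exists>(t :: nat \<Rightarrow> 'a list) w w' r.
        T = t ` {1..n} \<and>
        (\<forall>i \<in> {1..n}. \<forall>j \<in> {1..n}. i \<noteq> j \<longrightarrow> set (t i) \<inter> set (t j) = {}) \<and>
        0 < r \<and>
        (\<forall>i \<in> {1..n}.
           w i \<in> fsa_lang A W \<and> w' i \<in> fsa_lang A W \<and>
           r + n \<le> length (w i) \<and> r + n \<le> length (w' i) \<and>
           t i = subpath G (w i) r (r + n) \<and> t i = subpath G (w' i) r (r + n)) \<and>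
        (\<forall>i \<in> {1..<n}. \<exists>x \<in> A \<union> {\<one>\<^bsub>G\<^esub>}. accepts_pair A (M x) (w' i) (w (i + 1))))"

end

theory Submission
  imports Defs
begin

text \<open>
  Suppose that there are no \<open>n\<close>-tracks of length \<open>n\<close> for some \<open>n > 0\<close>. Then the Cayley graph is
  hyperbolic, for the following reasons.

  \<^emph>\<open>Geodesics stay close to accepted words.\<close> The accepted words form a geodesic spanning tree of
  the Cayley graph, rooted at the identity. Let \<open>f\<close> be a geodesic from the identity to a vertex at
  distance \<open>N\<close>, and let \<open>u t\<close> be the accepted word for \<open>f t\<close>. For a level \<open>r\<close>, let \<open>D r\<close> count
  the prefixes of length \<open>r\<close> of the words \<open>u t\<close> with \<open>r \<le> t \<le> N\<close>. Consecutive words \<open>u t\<close> are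
  accepted by a compare automaton, so their prefixes of length \<open>r\<close> are at bounded distance. Call a
  prefix split if it has two extensions to level \<open>r + n\<close> among these words. A sequence of \<open>n\<close>
  distinct unsplit prefixes that are consecutively linked gives \<open>n\<close>-tracks between the levels
  \<open>r\<close> and \<open>r + n\<close>, since distinct branches of a tree are disjoint. Without tracks, every prefix is
  therefore at bounded distance from a split one or from the starting one, so a large \<open>D r\<close> forces
  at least \<open>n\<close> split prefixes. Passing from level \<open>r\<close> to \<open>r + n\<close> discards at most \<open>n\<close> of the
  words, and \<open>n\<close> splittings compensate for this: \<open>D (r + n) \<ge> D r\<close>. This cannot go on beyond
  level \<open>N\<close>, so \<open>D r\<close> is bounded (\<open>few_prefixes_if_no_tracks\<close>), and the chain of prefixes that leads
  from \<open>f r\<close> to the prefix of \<open>u N\<close> is short (\<open>geodesic_near_normal_form\<close>). Together with the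
  fellow traveller property this shows that two geodesics with a common origin and with ends at
  distance at most 1 are uniformly close at all times.

  \<^emph>\<open>Thin bigons imply hyperbolicity\<close> (a theorem of Papasoglu). Two geodesics from \<open>x\<close> cannot run
  parallel at a distance between \<open>2 * K\<close> and \<open>B\<close> for longer than a time that depends on \<open>B\<close>
  (\<open>parallel_bound\<close>); hence once they are more than \<open>\<theta>\<close> apart, they are more than \<open>\<Lambda>\<close> apart after a
  fixed time \<open>r\<^sub>0\<close> (\<open>divergence\<close>). Splitting a path at a point whose geodesic to \<open>x\<close> is in the
  middle, one finds that the length of a path joining them outside a ball grows exponentially with
  the radius (\<open>exponential_divergence\<close>). Two sides of a triangle therefore diverge at least linearly,
  and a Morse argument confines the third side to a neighbourhood of them (\<open>thin_triangles\<close>).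
  The property passes from the vertices to the geometric Cayley graph, which is within distance 1
  of them (\<open>gromov_hyperbolic_if_roughly_isometric\<close>).
\<close>

section \<open>Geodesics and edge paths in an integer-valued metric\<close>

text \<open>A geodesic of length \<open>d x y\<close> is a function on all of \<open>nat\<close> that stays at \<open>y\<close> from time
  \<open>d x y\<close> on, so that geodesics of different lengths can be compared at all times.\<close>
definition geodesic_path :: "'v set \<Rightarrow> ('v \<Rightarrow> 'v \<Rightarrow> nat) \<Rightarrow> (nat \<Rightarrow> 'v) \<Rightarrow> 'v \<Rightarrow> 'v \<Rightarrow> bool" where
  "geodesic_path V d f x y \<longleftrightarrow>
     range f \<subseteq> V \<and> f 0 = x \<and> (\<forall>i\<ge>d x y. f i = y) \<and>
     (\<forall>i j. i \<le> j \<longrightarrow> j \<le> d x y \<longrightarrow> d (f i) (f j) + i = j)"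

text \<open>There is a path from \<open>p\<close> to \<open>q\<close> with at most \<open>m\<close> steps of length at most 1, all of whose
  points satisfy \<open>Q\<close>.\<close>
definition edge_path :: "'v set \<Rightarrow> ('v \<Rightarrow> 'v \<Rightarrow> nat) \<Rightarrow> ('v \<Rightarrow> bool) \<Rightarrow> nat \<Rightarrow> 'v \<Rightarrow> 'v \<Rightarrow> bool" where
  "edge_path V d Q m p q \<longleftrightarrow>
     (\<exists>f n. n \<le> m \<and> f 0 = p \<and> f n = q \<and> (\<forall>i\<le>n. f i \<in> V \<and> Q (f i)) \<and>
        (\<forall>i<n. d (f i) (f (Suc i)) \<le> 1))"

text \<open>The vertex set of a connected graph with its path metric, characterised by the existence of
  discrete geodesics.\<close>
locale graph_metric =
  fixes V :: "'v set" and d :: "'v \<Rightarrow> 'v \<Rightarrow> nat"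
  assumes dist_eq_0: "\<lbrakk>x \<in> V; y \<in> V\<rbrakk> \<Longrightarrow> d x y = 0 \<longleftrightarrow> x = y"
    and dist_sym: "\<lbrakk>x \<in> V; y \<in> V\<rbrakk> \<Longrightarrow> d x y = d y x"
    and dist_tri: "\<lbrakk>x \<in> V; y \<in> V; z \<in> V\<rbrakk> \<Longrightarrow> d x z \<le> d x y + d y z"
    and geodesic_exists: "\<lbrakk>x \<in> V; y \<in> V\<rbrakk> \<Longrightarrow> \<exists>f. geodesic_path V d f x y"
begin

abbreviation "geod \<equiv> geodesic_path V d"

lemma dist_self: "x \<in> V \<Longrightarrow> d x x = 0"
  using dist_eq_0 by simp

lemma geod_in: "geod f x y \<Longrightarrow> f i \<in> V"
  by (auto simp: geodesic_path_def)

lemma geod_start: "geod f x y \<Longrightarrow> f 0 = x"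
  by (auto simp: geodesic_path_def)

lemma geod_end: "geod f x y \<Longrightarrow> d x y \<le> i \<Longrightarrow> f i = y"
  by (auto simp: geodesic_path_def)

lemma geod_ends_in: "geod f x y \<Longrightarrow> x \<in> V \<and> y \<in> V"
  using geod_in geod_start geod_end by (metis order_refl)

lemma geod_dist: "geod f x y \<Longrightarrow> i \<le> j \<Longrightarrow> j \<le> d x y \<Longrightarrow> d (f i) (f j) + i = j"
  by (auto simp: geodesic_path_def)

lemma geod_clip: "geod f x y \<Longrightarrow> f i = f (min i (d x y))"
  by (metis geod_end min.cobounded2 min_def nle_le)

lemma geod_lipschitz:
  assumes "geod f x y" "i \<le> j"
  shows "d (f i) (f j) + i \<le> j"
proof -
  have "d (f (min i (d x y))) (f (min j (d x y))) + min i (d x y) = min j (d x y)"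
    by (rule geod_dist[OF assms(1)]) (use assms in auto)
  then have "d (f i) (f j) + min i (d x y) = min j (d x y)"
    by (simp only: geod_clip[OF assms(1), symmetric])
  then show ?thesis using assms(2) by linarith
qed

lemma geod_lipschitz':
  assumes "geod f x y" "i \<le> j"
  shows "d (f j) (f i) + i \<le> j"
  using geod_lipschitz[OF assms] dist_sym[of "f i" "f j"] geod_in[OF assms(1)] by simp

lemma geod_dist_start: "geod f x y \<Longrightarrow> i \<le> d x y \<Longrightarrow> d x (f i) = i"
  using geod_dist[of f x y 0 i] geod_start by fastforce

lemma geod_dist_end: "geod f x y \<Longrightarrow> i \<le> d x y \<Longrightarrow> d (f i) y + i = d x y"
  using geod_dist[of f x y i "d x y"] geod_end by fastforce

lemma geod_reverse:
  assumes "geod f x y"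
  shows "geod (\<lambda>i. f (d x y - i)) y x"
proof -
  have xy: "d y x = d x y" using dist_sym geod_ends_in[OF assms] by blast
  have "d (f (d x y - i)) (f (d x y - j)) + i = j" if "i \<le> j" "j \<le> d x y" for i j
  proof -
    have "d (f (d x y - j)) (f (d x y - i)) + (d x y - j) = d x y - i"
      by (rule geod_dist[OF assms]) (use that in auto)
    then show ?thesis
      using that dist_sym[OF geod_in[OF assms] geod_in[OF assms], of "d x y - j" "d x y - i"]
      by linarith
  qed
  then show ?thesis
    using geod_in[OF assms] geod_start[OF assms] geod_end[OF assms]
    by (auto simp: geodesic_path_def xy)
qed

lemma geod_sub:
  assumes "geod f x y" "i \<le> j" "j \<le> d x y"
  shows "geod (\<lambda>t. f (min (i + t) j)) (f i) (f j)"
proof -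
  have l: "d (f i) (f j) + i = j" using geod_dist assms by blast
  have "d (f (min (i + a) j)) (f (min (i + b) j)) + a = b" if "a \<le> b" "b + i \<le> j" for a b
    using geod_dist[OF assms(1), of "i + a" "i + b"] that assms by (simp add: min_def)
  moreover have "min (i + a) j = j" if "d (f i) (f j) \<le> a" for a using l that by linarith
  ultimately show ?thesis
    using geod_in[OF assms(1)] assms(2) l by (auto simp: geodesic_path_def)
qed

lemma geod_sub_rev:
  assumes "geod f x y" "i \<le> j" "j \<le> d x y"
  shows "geod (\<lambda>t. f (max i (j - t))) (f j) (f i)"
proof -
  have l: "d (f i) (f j) + i = j" using geod_dist assms by blast
  then have l': "d (f i) (f j) = j - i" by linarith
  have "(\<lambda>t. f (max i (j - t))) = (\<lambda>t. f (min (i + (d (f i) (f j) - t)) j))"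
    using assms(2) unfolding l' by (intro ext arg_cong[where f=f]) linarith
  then show ?thesis using geod_reverse[OF geod_sub[OF assms]] by simp
qed

lemma geod_concat:
  assumes "geod f x y" "geod g y z" "d x y + d y z = d x z"
  shows "geod (\<lambda>i. if i \<le> d x y then f i else g (i - d x y)) x z"
proof -
  let ?h = "\<lambda>i. if i \<le> d x y then f i else g (i - d x y)"
  have V: "\<And>i. f i \<in> V" "\<And>i. g i \<in> V" "x \<in> V" "y \<in> V" "z \<in> V"
    using geod_in assms geod_ends_in by blast+
  have lip: "d (?h i) (?h j) \<le> j - i" if "i \<le> j" for i j
  proof -
    consider "j \<le> d x y" | "d x y < i" | "i \<le> d x y" "d x y < j" by linarith
    then show ?thesis
    proof cases
      case 1
      then show ?thesis using geod_lipschitz[OF assms(1) that] that by simp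
    next
      case 2
      have "d (g (i - d x y)) (g (j - d x y)) + (i - d x y) \<le> j - d x y"
        by (rule geod_lipschitz[OF assms(2)]) (use that in simp)
      then show ?thesis using 2 that by simp
    next
      case 3
      have "d (f i) y + i \<le> d x y"
        using geod_lipschitz[OF assms(1) 3(1)] geod_end[OF assms(1)] by simp
      moreover have "d y (g (j - d x y)) \<le> j - d x y"
        using geod_lipschitz[OF assms(2), of 0 "j - d x y"] geod_start[OF assms(2)] by simp
      ultimately show ?thesis
        using dist_tri[OF V(1) V(4) V(2), of i "j - d x y"] 3 by simp
    qed
  qed
  have h0: "?h 0 = x" using geod_start[OF assms(1)] by simp
  have he: "?h i = z" if "d x z \<le> i" for i
  proof (cases "i \<le> d x y")
    case True
    then have "d y z = 0" using that assms(3) by linarith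
    then have "y = z" using dist_eq_0 V by blast
    moreover have "d x y \<le> i" using that assms(3) by linarith
    ultimately show ?thesis using geod_end[OF assms(1), of i] True by simp
  next
    case False
    then show ?thesis using geod_end[OF assms(2), of "i - d x y"] that assms(3) by auto
  qed
  have inV: "\<And>i. ?h i \<in> V" using V by simp
  have "d (?h i) (?h j) + i = j" if "i \<le> j" "j \<le> d x z" for i j
  proof -
    have "d x (?h i) \<le> i" using lip[of 0 i] h0 by simp
    moreover have "d (?h j) z \<le> d x z - j" using lip[OF that(2)] he[of "d x z"] by simp
    moreover have "d x z \<le> d x (?h i) + d (?h i) z" using dist_tri V(3,5) inV by blast
    moreover have "d (?h i) z \<le> d (?h i) (?h j) + d (?h j) z" using dist_tri V(3,5) inV by blast
    ultimately show ?thesis using lip[OF that(1)] that by linarith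
  qed
  then show ?thesis unfolding geodesic_path_def using inV h0 he by blast
qed

lemma edge_path_mono:
  assumes "edge_path V d Q m p q" "m \<le> m'" "\<And>v. v \<in> V \<Longrightarrow> Q v \<Longrightarrow> Q' v"
  shows "edge_path V d Q' m' p q"
proof -
  obtain f n where f: "n \<le> m" "f 0 = p" "f n = q" "\<forall>i\<le>n. f i \<in> V \<and> Q (f i)"
    "\<forall>i<n. d (f i) (f (Suc i)) \<le> 1"
    using assms(1) unfolding edge_path_def by blast
  show ?thesis
    unfolding edge_path_def using f assms(2,3) by (intro exI[of _ f] exI[of _ n]) auto
qed

lemma edge_path_sym:
  assumes "edge_path V d Q m p q"
  shows "edge_path V d Q m q p"
proof -
  obtain f n where f: "n \<le> m" "f 0 = p" "f n = q" "\<forall>i\<le>n. f i \<in> V \<and> Q (f i)"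
    "\<forall>i<n. d (f i) (f (Suc i)) \<le> 1"
    using assms unfolding edge_path_def by blast
  have "d (f (n - i)) (f (n - Suc i)) \<le> 1" if "i < n" for i
  proof -
    have "d (f (n - Suc i)) (f (Suc (n - Suc i))) \<le> 1" using f(5) that by simp
    then show ?thesis
      using that dist_sym[of "f (n - i)" "f (n - Suc i)"] f(4) by (simp add: Suc_diff_Suc)
  qed
  then show ?thesis
    unfolding edge_path_def using f by (intro exI[of _ "\<lambda>i. f (n - i)"] exI[of _ n]) simp
qed

lemma edge_path_trans:
  assumes "edge_path V d Q m p q" "edge_path V d Q m' q r"
  shows "edge_path V d Q (m + m') p r"
proof -
  obtain f n where f: "n \<le> m" "f 0 = p" "f n = q" "\<forall>i\<le>n. f i \<in> V \<and> Q (f i)"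
    "\<forall>i<n. d (f i) (f (Suc i)) \<le> 1"
    using assms(1) unfolding edge_path_def by blast
  obtain g k where g: "k \<le> m'" "g 0 = q" "g k = r" "\<forall>i\<le>k. g i \<in> V \<and> Q (g i)"
    "\<forall>i<k. d (g i) (g (Suc i)) \<le> 1"
    using assms(2) unfolding edge_path_def by blast
  let ?h = "\<lambda>i. if i \<le> n then f i else g (i - n)"
  have "d (?h i) (?h (Suc i)) \<le> 1" if "i < n + k" for i
  proof -
    consider "i < n" | "i = n" | "n < i" by linarith
    then show ?thesis
    proof cases
      case 2
      then show ?thesis using g(2) f(3) g(5) that by auto
    next
      case 3
      then show ?thesis using g(5)[rule_format, of "i - n"] that by (simp add: Suc_diff_le)
    qed (use f(5) in auto)
  qed
  moreover have "?h (n + k) = r" using f(3) g(2,3) by (cases "k = 0") auto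
  ultimately show ?thesis
    unfolding edge_path_def using f g
    by (intro exI[of _ ?h] exI[of _ "n + k"]) auto
qed

lemma geod_edge_path:
  assumes "geod f x y" "i \<le> j" "\<And>t. i \<le> t \<Longrightarrow> t \<le> j \<Longrightarrow> Q (f t)"
  shows "edge_path V d Q (j - i) (f i) (f j)"
proof -
  have "d (f (i + t)) (f (i + Suc t)) \<le> 1" for t
    using geod_lipschitz[OF assms(1), of "i + t" "i + Suc t"] by simp
  then show ?thesis
    unfolding edge_path_def using assms geod_in[OF assms(1)]
    by (intro exI[of _ "\<lambda>t. f (i + t)"] exI[of _ "j - i"]) auto
qed

end

section \<open>Divergence of geodesics\<close>

lemma linear_le_power2: "\<exists>M. \<forall>m\<ge>M. a * m + b \<le> (2::nat) ^ m"
proof (intro exI allI impI)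
  fix m :: nat
  assume m: "2 * (2 * a + b) \<le> m"
  define h where "h = m div 2"
  have h: "2 * h \<le> m" "m \<le> 2 * h + 1" unfolding h_def by linarith+
  have "a * m + b \<le> a * (2 * h + 1) + b" using mult_le_mono2[OF h(2)] by (rule add_le_mono1)
  also have "\<dots> \<le> (2 * a + b) * Suc h" by (simp add: algebra_simps)
  also have "\<dots> \<le> Suc h * Suc h" using m h(2) by (intro mult_le_mono1) presburger
  also have "\<dots> \<le> 2 ^ h * 2 ^ h" by (intro mult_le_mono) (simp_all add: Suc_leI)
  also have "\<dots> = 2 ^ (2 * h)" by (simp add: mult_2 power_add)
  also have "\<dots> \<le> 2 ^ m" using h by (intro power_increasing) auto
  finally show "a * m + b \<le> 2 ^ m" .
qed

lemma power2_le_linear_bound: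
  assumes "0 < (c::nat)"
  shows "\<exists>S. \<forall>s. (2::nat) ^ (s div c) \<le> a * s + b \<longrightarrow> s < S"
proof -
  obtain M where M: "\<forall>m\<ge>M. (a * c) * m + (a * c + b + 1) \<le> (2::nat) ^ m"
    using linear_le_power2 by blast
  have "s < c * M" if "(2::nat) ^ (s div c) \<le> a * s + b" for s
  proof (rule ccontr)
    assume "\<not> s < c * M"
    then have "M \<le> s div c" using assms by (simp add: less_eq_div_iff_mult_less_eq mult.commute)
    then have "(a * c) * (s div c) + (a * c + b + 1) \<le> 2 ^ (s div c)" using M by blast
    moreover have "s \<le> c * (s div c) + c"
      using mult_div_mod_eq[of c s] mod_less_divisor[OF assms, of s] by linarith
    then have "a * s \<le> a * (c * (s div c) + c)" by (rule mult_le_mono2)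
    ultimately show False using that by (simp add: algebra_simps)
  qed
  then show ?thesis by blast
qed

text \<open>Geodesics with the same origin whose ends are equal or adjacent stay \<open>K\<close>-close. Adjacent ends
  have to be included: in an odd cycle the geodesics between two vertices are unique.\<close>
locale thin_bigons = graph_metric V d for V :: "'v set" and d :: "'v \<Rightarrow> 'v \<Rightarrow> nat" +
  fixes K :: nat
  assumes K_pos: "0 < K"
    and fellow_1: "\<lbrakk>geod f x y; geod g x z; d y z \<le> 1\<rbrakk> \<Longrightarrow> d (f t) (g t) \<le> K"
begin

text \<open>Two points at the same distance from \<open>u\<close> on geodesics from \<open>u\<close> to \<open>w\<close> are close.\<close>
lemma bigon:
  assumes V: "u \<in> V" "v \<in> V" "v' \<in> V" "w \<in> V"
    and v: "d u v + d v w = d u w" and v': "d u v' + d v' w = d u w" and eq: "d u v = d u v'"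
  shows "d v v' \<le> K"
proof -
  obtain f f' g g' where *: "geod f u v" "geod f' u v'" "geod g v w" "geod g' v' w"
    using geodesic_exists V by meson
  from fellow_1[OF geod_concat[OF *(1,3) v] geod_concat[OF *(2,4) v'], of "d u v"]
  show ?thesis
    using geod_end[OF *(1)] geod_end[OF *(2)] eq dist_self[OF V(4)] by simp
qed

lemma fellow:
  assumes "geod f x y" "geod g x z"
  shows "d (f t) (g t) \<le> K * max 1 (d y z)"
proof -
  have "geod g x z \<Longrightarrow> d y z \<le> Suc m \<Longrightarrow> d (f t) (g t) \<le> K * Suc m" for m g z
  proof (induction m arbitrary: g z)
    case 0
    then show ?case using fellow_1[OF assms(1)] by simp
  next
    case (Suc m)
    show ?case
    proof (cases "d y z \<le> Suc m")
      case True
      then show ?thesis using Suc.IH[OF Suc.prems(1)] by fastforce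
    next
      case False
      then have l: "d y z = Suc (Suc m)" using Suc.prems by simp
      have V: "x \<in> V" "y \<in> V" "z \<in> V" using geod_ends_in Suc.prems(1) assms(1) by blast+
      obtain h where h: "geod h y z" using geodesic_exists V by blast
      obtain k where k: "geod k x (h (Suc m))" using geodesic_exists V geod_in[OF h] by blast
      have "d y (h (Suc m)) = Suc m" using geod_dist_start[OF h] l by simp
      then have 1: "d (f t) (k t) \<le> K * Suc m" using Suc.IH[OF k] by simp
      have "d (h (Suc m)) z = 1" using geod_dist_end[OF h, of "Suc m"] l by simp
      then have "d (k t) (g t) \<le> K" using fellow_1[OF k Suc.prems(1)] by simp
      then show ?thesis
        using 1 dist_tri[of "f t" "k t" "g t", OF geod_in[OF assms(1)] geod_in[OF k]
            geod_in[OF Suc.prems(1)]] by simp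
    qed
  qed
  from this[OF assms(2), of "max 1 (d y z) - 1"] show ?thesis by simp
qed

lemma fellow_back:
  assumes "geod f x y" "geod g x z" "j \<le> m" "m \<le> d x y" "m \<le> d x z"
  shows "d (f j) (g j) \<le> K * max 1 (d (f m) (g m))"
proof -
  have 1: "geod (\<lambda>t. f (min (0 + t) m)) (f 0) (f m)" "geod (\<lambda>t. g (min (0 + t) m)) (g 0) (g m)"
    using geod_sub assms by blast+
  have "f 0 = x" "g 0 = x" using geod_start assms by blast+
  then have "geod (\<lambda>t. f (min (0 + t) m)) x (f m)" "geod (\<lambda>t. g (min (0 + t) m)) x (g m)"
    using 1 by simp_all
  from fellow[OF this, of j] show ?thesis using assms(3) by simp
qed

text \<open>The key step. For \<open>a \<le> b\<close> the number \<open>v [a, b] = d (f a) (g b) - (b - a)\<close> can only grow when the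
  interval \<open>[a, b]\<close> shrinks, and it is at most \<open>B\<close>. If \<open>v\<close> has the same value \<open>E\<close> on an interval and
  on its first and last thirds, then there are two geodesics from \<open>f a\<close> to \<open>g b\<close>, one running
  along \<open>f\<close> through the first two thirds and one running along \<open>g\<close> through the last two. By thinness
  of this bigon, \<open>f\<close> and \<open>g\<close> are within \<open>2 * K\<close> of each other at some time. Otherwise one of the two thirds has a
  larger \<open>v\<close>, which can happen at most \<open>B\<close> times in succession.\<close>
lemma parallel_bound:
  assumes f: "geod f x y" and g: "geod g x z" and q: "q \<le> d x y" "q \<le> d x z"
    and far: "\<And>j. p \<le> j \<Longrightarrow> j \<le> q \<Longrightarrow> 2 * K < d (f j) (g j)"
    and bd: "\<And>j. p \<le> j \<Longrightarrow> j \<le> q \<Longrightarrow> d (f j) (g j) \<le> B"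
  shows "p \<le> a \<Longrightarrow> a + 3 ^ n * B \<le> q \<Longrightarrow> d (f a) (g (a + 3 ^ n * B)) + n \<le> 3 ^ n * B + B"
proof (induction n arbitrary: a)
  case 0
  have "d (f a) (g (a + B)) \<le> d (f a) (g a) + d (g a) (g (a + B))"
    using dist_tri geod_in f g by blast
  then show ?case using geod_lipschitz[OF g, of a "a + B"] bd[of a] 0 by simp
next
  case (Suc n)
  have V: "\<And>i. f i \<in> V" "\<And>i. g i \<in> V" "x \<in> V" using geod_in geod_ends_in f g by blast+
  define L where "L = 3 ^ n * B"
  have BL: "B \<le> L" unfolding L_def by simp
  have L3: "3 ^ Suc n * B = 3 * L" unfolding L_def by simp
  have aq: "a + 3 * L \<le> q" using Suc.prems(2) L3 by simp
  define F where "F = d (f a) (g (a + 3 * L))"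
  define F1 where "F1 = d (f a) (g (a + L))"
  define F2 where "F2 = d (f (a + 2 * L)) (g (a + 3 * L))"
  have IH1: "F1 + n \<le> L + B"
    using Suc.IH[of a] Suc.prems(1) aq unfolding F1_def L_def by simp
  have IH2: "F2 + n \<le> L + B"
    using Suc.IH[of "a + 2 * L"] Suc.prems(1) aq unfolding F2_def L_def by (simp add: algebra_simps)
  have t1: "F \<le> F1 + 2 * L"
    using dist_tri[of "f a" "g (a + L)" "g (a + 3 * L)"] V geod_lipschitz[OF g, of "a + L" "a + 3 * L"]
    unfolding F_def F1_def by simp
  have t2: "F \<le> F2 + 2 * L"
    using dist_tri[of "f a" "f (a + 2 * L)" "g (a + 3 * L)"] V
      geod_lipschitz[OF f, of "a" "a + 2 * L"]
    unfolding F_def F2_def by simp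
  show ?case
  proof (cases "F = F1 + 2 * L \<and> F = F2 + 2 * L")
    case False
    then have "F + Suc n \<le> 3 * L + B" using IH1 IH2 t1 t2 by linarith
    then show ?thesis unfolding L3 F_def .
  next
    case True
    have lev: "d x (f i) = i" "d x (g i) = i" if "i \<le> q" for i
      using geod_dist_start f g q that by (metis order_trans)+
    \<comment> \<open>Both thirds have the same excess \<open>E\<close> as the whole interval. The point \<open>v'\<close> of \<open>g\<close> is at
      distance \<open>2 * L\<close> from \<open>f a\<close>, like \<open>f (a + 2 * L)\<close>.\<close>
    have F1L: "L \<le> F1"
      using dist_tri[of x "f a" "g (a + L)"] V lev[of a] lev[of "a + L"] aq
      unfolding F1_def by simp
    define E where "E = F1 - L"
    have F1E: "F1 = L + E" using F1L E_def by simp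
    have EB: "E \<le> B" using IH1 F1E by simp
    have EL: "E \<le> L" using EB BL by simp
    define v' where "v' = g (a + 2 * L - E)"
    have F: "F = 3 * L + E" using True F1E by simp
    have F2: "F2 = L + E" using True F1E by simp
    have fa: "d (f a) (f (a + 2 * L)) = 2 * L"
      using geod_dist[OF f, of a "a + 2 * L"] aq q by simp
    have g1: "d (g (a + L)) v' + E = L"
      unfolding v'_def using geod_dist[OF g, of "a + L" "a + 2 * L - E"] aq q EL by linarith
    have g2: "d v' (g (a + 3 * L)) = L + E"
      unfolding v'_def using geod_dist[OF g, of "a + 2 * L - E" "a + 3 * L"] aq q EL by linarith
    have v'V: "v' \<in> V" using V v'_def by simp
    have "d (f a) v' \<le> 2 * L"
      using dist_tri[of "f a" "g (a + L)" v'] V v'V g1 F1E unfolding F1_def by simp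
    moreover have "F \<le> d (f a) v' + (L + E)"
      using dist_tri[of "f a" v' "g (a + 3 * L)"] V v'V g2 unfolding F_def by simp
    ultimately have fv': "d (f a) v' = 2 * L" using F by simp
    have "d (f (a + 2 * L)) v' \<le> K"
    proof (rule bigon[of "f a" _ _ "g (a + 3 * L)"])
      show "d (f a) (f (a + 2 * L)) + d (f (a + 2 * L)) (g (a + 3 * L)) = d (f a) (g (a + 3 * L))"
        using fa F F2 unfolding F_def F2_def by simp
      show "d (f a) v' + d v' (g (a + 3 * L)) = d (f a) (g (a + 3 * L))"
        using fv' g2 F unfolding F_def by simp
    qed (use V v'V fa fv' in auto)
    moreover have "d x (f (a + 2 * L)) \<le> d x v' + d v' (f (a + 2 * L))"
      using dist_tri V v'V by blast
    then have "E \<le> d (f (a + 2 * L)) v'"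
      using lev[of "a + 2 * L"] lev[of "a + 2 * L - E"] aq EL dist_sym[OF V(1) v'V, of "a + 2 * L"]
      unfolding v'_def by simp
    moreover have "d (f (a + 2 * L)) (g (a + 2 * L)) \<le> d (f (a + 2 * L)) v' + E"
      using dist_tri[of "f (a + 2 * L)" v' "g (a + 2 * L)"] V v'V
        geod_lipschitz[OF g, of "a + 2 * L - E" "a + 2 * L"] EL unfolding v'_def by simp
    ultimately have "d (f (a + 2 * L)) (g (a + 2 * L)) \<le> 2 * K" by simp
    moreover have "2 * K < d (f (a + 2 * L)) (g (a + 2 * L))"
      by (rule far) (use aq Suc.prems in auto)
    ultimately show ?thesis by simp
  qed
qed

text \<open>Two geodesics that are more than \<open>\<theta>\<close> apart remain more than \<open>2 * K\<close> apart from then on; they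
  are more than \<open>\<Lambda>\<close> apart after a further time \<open>r\<^sub>0\<close>, and \<open>\<Lambda>\<close> is large enough for the gap to be
  divided into two gaps of more than \<open>\<theta>\<close>.\<close>
definition \<theta> :: nat where "\<theta> = 2 * K * K"
definition \<Lambda> :: nat where "\<Lambda> = 2 * \<theta> + K"
definition r\<^sub>0 :: nat where "r\<^sub>0 = 3 ^ Suc (K * \<Lambda>) * (K * \<Lambda>)"

lemma K_le_\<theta>: "K \<le> \<theta>" and \<Lambda>_pos: "0 < \<Lambda>" and r\<^sub>0_pos: "0 < r\<^sub>0"
  using K_pos by (auto simp: \<theta>_def \<Lambda>_def r\<^sub>0_def)

lemma divergence:
  assumes f: "geod f x y" and g: "geod g x z" and len: "R + r\<^sub>0 \<le> d x y" "R + r\<^sub>0 \<le> d x z"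
    and far: "\<theta> < d (f R) (g R)"
  shows "\<Lambda> < d (f (R + r\<^sub>0)) (g (R + r\<^sub>0))"
proof (rule ccontr)
  assume c: "\<not> ?thesis"
  define B where "B = K * \<Lambda>"
  have V: "\<And>i. f i \<in> V" "\<And>i. g i \<in> V" "x \<in> V" using geod_in geod_ends_in f g by blast+
  have r: "r\<^sub>0 = 3 ^ Suc B * B" unfolding r\<^sub>0_def B_def by simp
  have 1: "d (f j) (g j) \<le> B" if "R \<le> j" "j \<le> R + r\<^sub>0" for j
  proof -
    have "d (f j) (g j) \<le> K * max 1 (d (f (R + r\<^sub>0)) (g (R + r\<^sub>0)))"
      by (rule fellow_back[OF f g that(2) len])
    also have "\<dots> \<le> K * \<Lambda>" using c \<Lambda>_pos by (intro mult_le_mono2) auto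
    finally show ?thesis unfolding B_def .
  qed
  have 2: "2 * K < d (f j) (g j)" if "R \<le> j" "j \<le> R + r\<^sub>0" for j
  proof (rule ccontr)
    assume "\<not> 2 * K < d (f j) (g j)"
    then have "K * max 1 (d (f j) (g j)) \<le> K * (2 * K)" using K_pos by (intro mult_le_mono2) auto
    moreover have "d (f R) (g R) \<le> K * max 1 (d (f j) (g j))"
      by (rule fellow_back[OF f g that(1)]) (use len that in auto)
    ultimately show False
      using far unfolding \<theta>_def by linarith
  qed
  have 3: "d (f R) (g (R + r\<^sub>0)) + Suc B \<le> r\<^sub>0 + B"
    using parallel_bound[OF f g len, of R B R "Suc B"] 1 2 r by simp
  have "d x (g (R + r\<^sub>0)) \<le> d x (f R) + d (f R) (g (R + r\<^sub>0))" using dist_tri V by blast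
  then show False using 3 geod_dist_start[OF f, of R] geod_dist_start[OF g, of "R + r\<^sub>0"] len by simp
qed

text \<open>Induction on \<open>k\<close>: at time \<open>R + r\<^sub>0\<close> the geodesics to the ends of the path are more than
  \<open>\<Lambda> = 2 * \<theta> + K\<close> apart, while the geodesics to consecutive points of the path are \<open>K\<close>-close. Hence
  the geodesic to a suitable point of the path is more than \<open>\<theta>\<close> from both, and the induction
  hypothesis applies to the two parts of the path.\<close>
lemma exponential_divergence_fun:
  "\<lbrakk>geod f x (p 0); geod g x (p m); \<And>i. i \<le> m \<Longrightarrow> p i \<in> V \<and> R + k * r\<^sub>0 \<le> d x (p i);
    \<And>i. i < m \<Longrightarrow> d (p i) (p (Suc i)) \<le> 1; \<theta> < d (f R) (g R)\<rbrakk> \<Longrightarrow> 2 ^ k \<le> m"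
proof (induction k arbitrary: f g p m R)
  case 0
  have "m \<noteq> 0"
  proof
    assume "m = 0"
    then have "d (f R) (g R) \<le> K" using fellow_1[OF 0(1), of g "p m"] 0(2,3) dist_self by simp
    then show False using 0(5) K_le_\<theta> by simp
  qed
  then show ?case by simp
next
  case (Suc k)
  have m: "m \<noteq> 0"
  proof
    assume "m = 0"
    then have "d (f R) (g R) \<le> K" using fellow_1[OF Suc(2), of g "p m"] Suc(3,4) dist_self by simp
    then show False using Suc(6) K_le_\<theta> by simp
  qed
  have xV: "x \<in> V" using geod_ends_in Suc(2) by blast
  define h where "h i = (if i = 0 then f else if i = m then g else (SOME h. geod h x (p i)))" for i
  have h: "geod (h i) x (p i)" if "i \<le> m" for i
    using Suc(2,3) that someI_ex[OF geodesic_exists[OF xV, of "p i"]] Suc(4)[OF that]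
    unfolding h_def by auto
  have h0: "h 0 = f" and hm: "h m = g" using m by (auto simp: h_def)
  define S where "S = R + r\<^sub>0"
  have bal: "\<And>i. i \<le> m \<Longrightarrow> S + k * r\<^sub>0 \<le> d x (p i)"
    using Suc(4) unfolding S_def by (simp add: algebra_simps)
  have "S \<le> d x (p 0)" "S \<le> d x (p m)" using bal[of 0] bal[of m] by simp_all
  then have big: "\<Lambda> < d (h 0 S) (h m S)"
    using divergence[OF Suc(2,3) _ _ Suc(6)] h0 hm unfolding S_def by simp
  have V: "h i S \<in> V" if "i \<le> m" for i using geod_in h that by blast
  let ?P = "\<lambda>i. i \<le> m \<and> \<theta> < d (h 0 S) (h i S)"
  define i where "i = (LEAST i. ?P i)"
  have "?P m" using big unfolding \<Lambda>_def by simp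
  then have Pi: "?P i" unfolding i_def by (rule LeastI)
  have "d (h 0 S) (h 0 S) = 0" using dist_self V[of 0] by simp
  then have "i \<noteq> 0" using Pi by (cases "i = 0") auto
  then obtain j where j: "i = Suc j" using not0_implies_Suc by blast
  have "\<not> ?P j" using not_less_Least[of j ?P] j unfolding i_def by simp
  then have "d (h 0 S) (h j S) \<le> \<theta>" using Pi j by simp
  moreover have "d (h j S) (h i S) \<le> K"
    using fellow_1[OF h h] Suc(5)[of j] Pi j by simp
  ultimately have "d (h 0 S) (h i S) \<le> \<theta> + K"
    using dist_tri[of "h 0 S" "h j S" "h i S"] V Pi j by simp
  then have far: "\<theta> < d (h i S) (h m S)"
    using dist_tri[of "h 0 S" "h i S" "h m S"] V Pi big unfolding \<Lambda>_def by simp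
  have "2 ^ k \<le> i"
    by (rule Suc.IH[of f p "h i" i S]) (use Suc(2) h Pi bal Suc(4,5) h0 in auto)
  moreover have "2 ^ k \<le> m - i"
  proof (rule Suc.IH[of "h i" "\<lambda>j. p (i + j)" g "m - i" S])
    show "geod (h i) x (p (i + 0))" using h Pi by simp
    show "geod g x (p (i + (m - i)))" using Suc(3) Pi by simp
    show "p (i + l) \<in> V \<and> S + k * r\<^sub>0 \<le> d x (p (i + l))" if "l \<le> m - i" for l
    proof -
      have "i + l \<le> m" using that Pi by linarith
      then show ?thesis using Suc(4)[of "i + l"] bal[of "i + l"] by simp
    qed
    show "d (p (i + l)) (p (i + Suc l)) \<le> 1" if "l < m - i" for l
      using that Pi Suc(5) by simp
    show "\<theta> < d (h i S) (g S)" using far hm by simp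
  qed
  ultimately show ?case using Pi by simp
qed

lemma exponential_divergence:
  assumes "geod f x y" "geod g x z" "edge_path V d (\<lambda>v. R + k * r\<^sub>0 \<le> d x v) m y z"
    and "\<theta> < d (f R) (g R)"
  shows "2 ^ k \<le> m"
proof -
  obtain p n where p: "n \<le> m" "p 0 = y" "p n = z" "\<forall>i\<le>n. p i \<in> V \<and> R + k * r\<^sub>0 \<le> d x (p i)"
    "\<forall>i<n. d (p i) (p (Suc i)) \<le> 1"
    using assms(3) unfolding edge_path_def by blast
  have "2 ^ k \<le> n"
    by (rule exponential_divergence_fun[of f x p g n R]) (use p assms in auto)
  then show ?thesis using p(1) by simp
qed

text \<open>A geodesic of length \<open>e < s\<close> between \<open>f (R + s)\<close> and \<open>g (R + s)\<close> stays outside the ball of radius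
  \<open>R + s / 2\<close> about \<open>x\<close>, so \<open>e\<close> is exponentially large in \<open>s\<close>; this bounds \<open>s\<close>.\<close>
lemma linear_divergence:
  "\<exists>S. \<forall>x y z f g R s. geod f x y \<longrightarrow> geod g x z \<longrightarrow> R + s \<le> d x y \<longrightarrow> R + s \<le> d x z \<longrightarrow>
     \<theta> < d (f R) (g R) \<longrightarrow> s \<le> d (f (R + s)) (g (R + s)) + S"
proof -
  obtain S where S: "\<And>s. (2::nat) ^ (s div (2 * r\<^sub>0)) \<le> 1 * s + 0 \<Longrightarrow> s < S"
    using power2_le_linear_bound[of "2 * r\<^sub>0" 1 0] r\<^sub>0_pos by auto
  have "s \<le> d (f (R + s)) (g (R + s)) + S"
    if f: "geod f x y" and g: "geod g x z" and l: "R + s \<le> d x y" "R + s \<le> d x z"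
      and far: "\<theta> < d (f R) (g R)" for x y z f g R s
  proof (cases "s \<le> d (f (R + s)) (g (R + s))")
    case False
    define e where "e = d (f (R + s)) (g (R + s))"
    have V: "x \<in> V" "\<And>i. f i \<in> V" "\<And>i. g i \<in> V" using geod_in geod_ends_in f g by blast+
    obtain h where h: "geod h (f (R + s)) (g (R + s))" using geodesic_exists V by blast
    have hV: "\<And>i. h i \<in> V" using geod_in h by blast
    define k where "k = s div (2 * r\<^sub>0)"
    have k: "2 * (k * r\<^sub>0) \<le> s" unfolding k_def using times_div_less_eq_dividend[of "2 * r\<^sub>0" s]
      by (simp add: algebra_simps)
    have f': "geod (\<lambda>t. f (min (0 + t) (R + s))) x (f (R + s))"
      using geod_sub[OF f, of 0 "R + s"] l geod_start[OF f] by simp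
    have g': "geod (\<lambda>t. g (min (0 + t) (R + s))) x (g (R + s))"
      using geod_sub[OF g, of 0 "R + s"] l geod_start[OF g] by simp
    have "R + k * r\<^sub>0 \<le> d x (h i)" if "i \<le> e" for i
    proof -
      have "d x (f (R + s)) = R + s" "d x (g (R + s)) = R + s" using geod_dist_start f g l by blast+
      moreover have "d x (f (R + s)) \<le> d x (h i) + d (h i) (f (R + s))" using dist_tri V hV by blast
      moreover have "d x (g (R + s)) \<le> d x (h i) + d (h i) (g (R + s))" using dist_tri V hV by blast
      moreover have "d (h i) (f (R + s)) \<le> i"
        using geod_lipschitz'[OF h, of 0 i] geod_start[OF h] by simp
      moreover have "d (h i) (g (R + s)) + i = e" using geod_dist_end[OF h] that e_def by blast
      ultimately show ?thesis using False k unfolding e_def[symmetric] by linarith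
    qed
    then have "edge_path V d (\<lambda>v. R + k * r\<^sub>0 \<le> d x v) (e - 0) (h 0) (h e)"
      by (intro geod_edge_path[OF h]) auto
    then have "edge_path V d (\<lambda>v. R + k * r\<^sub>0 \<le> d x v) e (f (R + s)) (g (R + s))"
      using geod_start[OF h] geod_end[OF h] e_def by simp
    from exponential_divergence[OF f' g' this] have "2 ^ k \<le> e" using far by simp
    then have "s < S" using S[of s] False unfolding k_def e_def by linarith
    then show ?thesis by simp
  qed simp
  then show ?thesis by blast
qed

text \<open>Until time \<open>R\<close> the two geodesics are close; at time \<open>R\<close> they either separate or one of them
  ends.\<close>
lemma separation_time:
  assumes f: "geod f x y" and g: "geod g x z"
  obtains R where "R \<le> d x y" "R \<le> d x z" "\<And>j. j \<le> R \<Longrightarrow> d (f j) (g j) \<le> \<theta> + 2"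
    "\<theta> < d (f R) (g R) \<or> R = d x y \<or> R = d x z"
proof -
  define m where "m = min (d x y) (d x z)"
  define R where "R = (LEAST i. \<theta> < d (f i) (g i) \<or> i = m)"
  have R: "\<theta> < d (f R) (g R) \<or> R = m" unfolding R_def by (rule LeastI[of _ m]) simp
  have Rm: "R \<le> m" unfolding R_def by (rule Least_le) simp
  have less: "d (f j) (g j) \<le> \<theta>" if "j < R" for j
    using not_less_Least[of j] that unfolding R_def by fastforce
  have V: "\<And>i. f i \<in> V" "\<And>i. g i \<in> V" using geod_in f g by blast+
  have "d (f R) (g R) \<le> \<theta> + 2"
  proof (cases R)
    case 0
    then show ?thesis using geod_start[OF f] geod_start[OF g] dist_self geod_ends_in[OF f] by simp
  next
    case (Suc j)
    have "d (f j) (g j) \<le> \<theta>" using less Suc by simp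
    moreover have "d (f (Suc j)) (f j) \<le> 1" using geod_lipschitz'[OF f, of j "Suc j"] by simp
    moreover have "d (g j) (g (Suc j)) \<le> 1" using geod_lipschitz[OF g, of j "Suc j"] by simp
    moreover have "d (f R) (g R) \<le> d (f R) (f j) + d (f j) (g R)" using dist_tri V by blast
    moreover have "d (f j) (g R) \<le> d (f j) (g j) + d (g j) (g R)" using dist_tri V by blast
    ultimately show ?thesis unfolding Suc by linarith
  qed
  then have "d (f j) (g j) \<le> \<theta> + 2" if "j \<le> R" for j
    using less[of j] that by (cases "j = R") auto
  then show ?thesis
    using that[of R] R Rm unfolding m_def by (auto simp: min_def split: if_splits)
qed

lemma geod_edge_path':
  assumes "geod f x y" "i \<le> d x y" "j \<le> d x y" "\<And>t. Q (f t)"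
  shows "edge_path V d Q (d (f i) (f j)) (f i) (f j)"
proof -
  have *: "edge_path V d Q (d (f i) (f j)) (f i) (f j) \<and> edge_path V d Q (d (f i) (f j)) (f j) (f i)"
    if "i \<le> j" "j \<le> d x y" for i j
  proof -
    have "d (f i) (f j) = j - i" using geod_dist[OF assms(1) that] by linarith
    then show ?thesis using geod_edge_path[OF assms(1) that(1), of Q] assms(4) edge_path_sym by simp
  qed
  have "d (f i) (f j) = d (f j) (f i)" using dist_sym geod_in[OF assms(1)] by blast
  then show ?thesis using *[of i j] *[of j i] assms(2,3) by (metis nle_le)
qed

section \<open>Thin triangles\<close>

text \<open>The union of two sides of a triangle is quasiconvex: points on them are joined by a path of
  linearly bounded length close to the sides. If both points lie beyond the separation time \<open>R\<close>,
  the path runs back to time \<open>R\<close>, and its length is controlled by linear divergence; otherwise it can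
  change sides right away.\<close>
lemma sides_connected:
  "\<exists>C. \<forall>x y z f g s t. geod f x y \<longrightarrow> geod g x z \<longrightarrow> s \<le> d x y \<longrightarrow> t \<le> d x z \<longrightarrow>
     edge_path V d (\<lambda>v. \<exists>j. d v (f j) \<le> \<theta> + 2 \<or> d v (g j) \<le> \<theta> + 2)
       (5 * d (f s) (g t) + C) (f s) (g t)"
proof -
  obtain S where S: "\<And>x y z f g R s. \<lbrakk>geod f x y; geod g x z; R + s \<le> d x y; R + s \<le> d x z;
     \<theta> < d (f R) (g R)\<rbrakk> \<Longrightarrow> s \<le> d (f (R + s)) (g (R + s)) + S"
    using linear_divergence by blast
  have "edge_path V d (\<lambda>v. \<exists>j. d v (f j) \<le> \<theta> + 2 \<or> d v (g j) \<le> \<theta> + 2)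
       (5 * d (f s) (g t) + (2 * S + \<theta> + 2)) (f s) (g t)"
    if f: "geod f x y" and g: "geod g x z" and s: "s \<le> d x y" and t: "t \<le> d x z"
    for x y z f g s t
  proof -
    let ?Q = "\<lambda>v. \<exists>j. d v (f j) \<le> \<theta> + 2 \<or> d v (g j) \<le> \<theta> + 2"
    have V: "x \<in> V" "\<And>i. f i \<in> V" "\<And>i. g i \<in> V" using geod_in geod_ends_in f g by blast+
    define e where "e = d (f s) (g t)"
    obtain R where R: "R \<le> d x y" "R \<le> d x z" "\<And>j. j \<le> R \<Longrightarrow> d (f j) (g j) \<le> \<theta> + 2"
      and R': "\<theta> < d (f R) (g R) \<or> R = d x y \<or> R = d x z"
      using separation_time[OF f g] by blast
    have Qf: "?Q (f i)" and Qg: "?Q (g i)" for i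
      using dist_self[OF V(2), of i] dist_self[OF V(3), of i] by (metis zero_le)+
    have dx: "d x (f s) = s" "d x (g t) = t" using geod_dist_start f g s t by blast+
    have st: "s \<le> t + e" "t \<le> s + e"
      using dist_tri[of x "f s" "g t"] dist_tri[of x "g t" "f s"] dist_sym[of "f s" "g t"] V dx
      unfolding e_def by auto
    have jump: "edge_path V d ?Q (\<theta> + 2) (f j) (g j)" if "j \<le> R" for j
    proof -
      obtain h where h: "geod h (f j) (g j)" using geodesic_exists V by blast
      have b: "d (f j) (g j) \<le> \<theta> + 2" using R(3) that by blast
      have "?Q (h i)" for i
      proof -
        have "d (h (min i (d (f j) (g j)))) (f j) \<le> d (f j) (g j)"
          using geod_lipschitz'[OF h, of 0 "min i (d (f j) (g j))"] geod_start[OF h] by simp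
        then show ?thesis using b geod_clip[OF h, of i] by (metis le_trans)
      qed
      then have "edge_path V d ?Q (d (f j) (g j) - 0) (h 0) (h (d (f j) (g j)))"
        by (intro geod_edge_path[OF h]) auto
      then show ?thesis
        using geod_start[OF h] geod_end[OF h] b by (auto intro: edge_path_mono)
    qed
    have pf: "edge_path V d ?Q (d (f i) (f j)) (f i) (f j)" if "i \<le> d x y" "j \<le> d x y" for i j
      by (rule geod_edge_path'[OF f that]) (rule Qf)
    have pg: "edge_path V d ?Q (d (g i) (g j)) (g i) (g j)" if "i \<le> d x z" "j \<le> d x z" for i j
      by (rule geod_edge_path'[OF g that]) (rule Qg)
    have df: "d (f i) (f j) + min i j \<le> max i j" for i j
      using geod_lipschitz[OF f, of i j] geod_lipschitz'[OF f, of j i] by (cases "i \<le> j") auto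
    have dg: "d (g i) (g j) + min i j \<le> max i j" for i j
      using geod_lipschitz[OF g, of i j] geod_lipschitz'[OF g, of j i] by (cases "i \<le> j") auto
    consider "s \<le> R" | "t \<le> R" | "R < s" "R < t" by linarith
    then show ?thesis
    proof cases
      case 1
      have "edge_path V d ?Q (\<theta> + 2 + d (g s) (g t)) (f s) (g t)"
        by (rule edge_path_trans[OF jump[OF 1] pg]) (use 1 R t in auto)
      then show ?thesis
        by (rule edge_path_mono) (use dg[of s t] st e_def in linarith)
    next
      case 2
      have "edge_path V d ?Q (d (f s) (f t) + (\<theta> + 2)) (f s) (g t)"
        by (rule edge_path_trans[OF pf jump[OF 2]]) (use 2 R s in auto)
      then show ?thesis
        by (rule edge_path_mono) (use df[of s t] st e_def in linarith)
    next
      case 3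
      then have far: "\<theta> < d (f R) (g R)" using R' s t by linarith
      define m where "m = min s t - R"
      have m: "R + m = min s t" unfolding m_def using 3 by linarith
      have "m \<le> d (f (R + m)) (g (R + m)) + S"
        by (rule S[OF f g _ _ far]) (use m s t in auto)
      moreover have "d (f (R + m)) (g (R + m)) \<le> d (f (R + m)) (f s) + d (f s) (g (R + m))"
        "d (f s) (g (R + m)) \<le> d (f s) (g t) + d (g t) (g (R + m))"
        using dist_tri V by blast+
      ultimately have mb: "m \<le> 2 * e + S"
        using df[of "R + m" s] dg[of t "R + m"] st unfolding m e_def[symmetric] by linarith
      have "edge_path V d ?Q (d (f s) (f R) + ((\<theta> + 2) + d (g R) (g t))) (f s) (g t)"
        by (rule edge_path_trans[OF pf edge_path_trans[OF jump pg]]) (use R s t in auto)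
      then show ?thesis
        by (rule edge_path_mono)
          (use df[of s R] dg[of R t] mb m st e_def 3 in linarith)
    qed
  qed
  then show ?thesis by blast
qed

lemma sides_connected_all:
  "\<exists>C. \<forall>x y z f g p q. geod f x y \<longrightarrow> geod g x z \<longrightarrow> p \<in> range f \<union> range g \<longrightarrow>
     q \<in> range f \<union> range g \<longrightarrow>
     edge_path V d (\<lambda>v. \<exists>u \<in> range f \<union> range g. d v u \<le> \<theta> + 2) (5 * d p q + C) p q"
proof -
  obtain C where C: "\<And>x y z f g s t. \<lbrakk>geod f x y; geod g x z; s \<le> d x y; t \<le> d x z\<rbrakk> \<Longrightarrow>
     edge_path V d (\<lambda>v. \<exists>j. d v (f j) \<le> \<theta> + 2 \<or> d v (g j) \<le> \<theta> + 2)
       (5 * d (f s) (g t) + C) (f s) (g t)"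
    using sides_connected by blast
  have "edge_path V d (\<lambda>v. \<exists>u \<in> range f \<union> range g. d v u \<le> \<theta> + 2) (5 * d p q + C) p q"
    if f: "geod f x y" and g: "geod g x z" and p: "p \<in> range f \<union> range g"
      and q: "q \<in> range f \<union> range g" for x y z f g p q
  proof -
    let ?Q = "\<lambda>v. \<exists>u \<in> range f \<union> range g. d v u \<le> \<theta> + 2"
    have V: "\<And>i. f i \<in> V" "\<And>i. g i \<in> V" using geod_in f g by blast+
    have rf: "\<exists>i\<le>d x y. v = f i" if "v \<in> range f" for v
      using that geod_clip[OF f] by (metis min.cobounded2 rangeE)
    have rg: "\<exists>i\<le>d x z. v = g i" if "v \<in> range g" for v
      using that geod_clip[OF g] by (metis min.cobounded2 rangeE)
    have Qf: "?Q (f i)" and Qg: "?Q (g i)" for i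
      by (rule bexI[of _ "f i"], use dist_self[OF V(1)] in auto)
        (rule bexI[of _ "g i"], use dist_self[OF V(2)] in auto)
    have fg: "edge_path V d ?Q (5 * d (f i) (g j) + C) (f i) (g j)" if "i \<le> d x y" "j \<le> d x z" for i j
      by (rule edge_path_mono[OF C[OF f g that]]) auto
    consider "p \<in> range f" "q \<in> range f" | "p \<in> range g" "q \<in> range g"
      | "p \<in> range f" "q \<in> range g" | "p \<in> range g" "q \<in> range f"
      using p q by blast
    then show ?thesis
    proof cases
      case 1
      then obtain i j where "i \<le> d x y" "p = f i" "j \<le> d x y" "q = f j" using rf by meson
      then show ?thesis using edge_path_mono[OF geod_edge_path'[OF f, of i j ?Q]] Qf by simp
    next
      case 2
      then obtain i j where "i \<le> d x z" "p = g i" "j \<le> d x z" "q = g j" using rg by meson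
      then show ?thesis using edge_path_mono[OF geod_edge_path'[OF g, of i j ?Q]] Qg by simp
    next
      case 3
      then obtain i j where "i \<le> d x y" "p = f i" "j \<le> d x z" "q = g j" using rf rg by meson
      then show ?thesis using fg by simp
    next
      case 4
      then obtain i j where ij: "i \<le> d x z" "p = g i" "j \<le> d x y" "q = f j" using rf rg by meson
      then have "d p q = d (f j) (g i)" using dist_sym V by blast
      then show ?thesis using edge_path_sym[OF fg[OF ij(3,1)]] ij by simp
    qed
  qed
  then show ?thesis by blast
qed

text \<open>Morse argument: let \<open>p\<close> be a point of the third side \<open>h\<close> at maximal distance \<open>D\<close> from the
  union of the other two sides. Walking along \<open>h\<close> a distance \<open>2 * D\<close> from \<open>p\<close> in both directions (or
  to the end of \<open>h\<close>), crossing to the other sides and connecting along them gives a path of length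
  linear in \<open>D\<close> that avoids a ball of radius almost \<open>D\<close> about \<open>p\<close>. It joins two geodesics from
  \<open>p\<close> that run in opposite directions, so its length is exponential in \<open>D\<close>.\<close>
theorem thin_triangles:
  "\<exists>D. \<forall>x y z f g h. geod f x y \<longrightarrow> geod g x z \<longrightarrow> geod h y z \<longrightarrow>
     (\<forall>i. \<exists>u \<in> range f \<union> range g. d (h i) u \<le> D)"
proof -
  obtain C where C: "\<And>x y z f g p q. \<lbrakk>geod f x y; geod g x z; p \<in> range f \<union> range g;
      q \<in> range f \<union> range g\<rbrakk> \<Longrightarrow>
     edge_path V d (\<lambda>v. \<exists>u \<in> range f \<union> range g. d v u \<le> \<theta> + 2) (5 * d p q + C) p q"
    using sides_connected_all by blast
  define H where "H = (\<theta> + 2) + Suc \<theta>"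
  obtain S where S: "\<And>s. (2::nat) ^ (s div r\<^sub>0) \<le> 32 * s + (32 * H + C) \<Longrightarrow> s < S"
    using power2_le_linear_bound[OF r\<^sub>0_pos] by blast
  have "\<exists>u \<in> range f \<union> range g. d (h i) u \<le> S + H"
    if f: "geod f x y" and g: "geod g x z" and h: "geod h y z" for x y z f g h i
  proof -
    let ?N = "range f \<union> range g"
    have V: "x \<in> V" "y \<in> V" "z \<in> V" "\<And>i. f i \<in> V" "\<And>i. g i \<in> V" "\<And>i. h i \<in> V"
      using geod_in geod_ends_in f g h by blast+
    have NV: "u \<in> V" if "u \<in> ?N" for u using that V by auto
    define \<rho> where "\<rho> i = (LEAST n. \<exists>u\<in>?N. d (h i) u = n)" for i
    have \<rho>_ex: "\<exists>u\<in>?N. d (h i) u = \<rho> i" for i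
      unfolding \<rho>_def by (rule LeastI_ex) blast
    have \<rho>_le: "\<rho> i \<le> d (h i) u" if "u \<in> ?N" for i u
      unfolding \<rho>_def by (rule Least_le) (use that in blast)
    have "Max (\<rho> ` {..d y z}) \<in> \<rho> ` {..d y z}" by (rule Max_in) auto
    then obtain i\<^sub>0 where i0: "i\<^sub>0 \<le> d y z" "\<rho> i\<^sub>0 = Max (\<rho> ` {..d y z})"
      by (metis atMost_iff imageE)
    have \<rho>max: "\<rho> i \<le> \<rho> i\<^sub>0" for i
    proof -
      have "\<rho> (min i (d y z)) \<le> \<rho> i\<^sub>0" unfolding i0(2) by (rule Max_ge) auto
      then show ?thesis unfolding \<rho>_def using geod_clip[OF h, of i] by simp
    qed
    define D where "D = \<rho> i\<^sub>0"
    define p where "p = h i\<^sub>0"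
    have pV: "p \<in> V" using V p_def by simp
    have p_far: "D \<le> d p u" if "u \<in> ?N" for u using \<rho>_le[OF that] unfolding D_def p_def .
    have near: "\<exists>u\<in>?N. d (h i) u \<le> D" for i using \<rho>_ex[of i] \<rho>max[of i] unfolding D_def by metis
    have "y \<in> ?N" using geod_end[OF f, of "d x y"] by (metis UnI1 order_refl rangeI)
    then have Dl: "D \<le> i\<^sub>0"
      using p_far geod_lipschitz'[OF h, of 0 i\<^sub>0] geod_start[OF h] unfolding p_def by fastforce
    have "z \<in> ?N" using geod_end[OF g, of "d x z"] by (metis UnI2 order_refl rangeI)
    then have Dr: "D + i\<^sub>0 \<le> d y z"
      using p_far geod_dist_end[OF h i0(1)] unfolding p_def by fastforce
    have hp: "d p (h i) = (if i \<le> i\<^sub>0 then i\<^sub>0 - i else i - i\<^sub>0)" if "i \<le> d y z" for i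
      using geod_dist[OF h, of i i\<^sub>0] geod_dist[OF h, of i\<^sub>0 i] that i0(1) dist_sym[OF pV, of "h i"] V
      unfolding p_def by auto
    \<comment> \<open>From a point of \<open>h\<close> at distance \<open>2 * D\<close> from \<open>p\<close>, or from one that already lies on the other
      sides, one reaches these sides while staying at distance at least \<open>D\<close> from \<open>p\<close>.\<close>
    have reach: "\<exists>u\<in>?N. edge_path V d (\<lambda>v. D \<le> d p v) D (h i) u \<and> d (h i) u \<le> D"
      if i: "i \<le> d y z" and far: "d p (h i) = 2 * D \<or> h i \<in> ?N" for i
    proof (cases "h i \<in> ?N")
      case True
      have "edge_path V d (\<lambda>v. D \<le> d p v) D (h i) (h i)"
        unfolding edge_path_def
        by (rule exI[of _ "\<lambda>_. h i"], rule exI[of _ 0]) (use V p_far[OF True] in auto)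
      then show ?thesis using True dist_self[OF V(6), of i] by force
    next
      case False
      then have far: "d p (h i) = 2 * D" using that by blast
      obtain u where u: "u \<in> ?N" "d (h i) u \<le> D" using near by blast
      obtain k where k: "geod k (h i) u" using geodesic_exists V NV[OF u(1)] by blast
      have kV: "\<And>t. k t \<in> V" using geod_in k by blast
      have kD: "D \<le> d p (k t)" for t
      proof -
        have "d (k (min t (d (h i) u))) (h i) \<le> D"
          using geod_lipschitz'[OF k, of 0 "min t (d (h i) u)"] geod_start[OF k] u(2) by simp
        then have "d (k t) (h i) \<le> D" using geod_clip[OF k, of t] by simp
        moreover have "d p (h i) \<le> d p (k t) + d (k t) (h i)" using dist_tri pV kV V by blast
        ultimately show ?thesis using far by linarith
      qed
      have "edge_path V d (\<lambda>v. D \<le> d p v) (d (h i) u - 0) (k 0) (k (d (h i) u))"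
        by (intro geod_edge_path[OF k]) (use kD in auto)
      then have "edge_path V d (\<lambda>v. D \<le> d p v) D (h i) u"
        using u(2) geod_start[OF k] geod_end[OF k] by (auto intro: edge_path_mono)
      then show ?thesis using u by blast
    qed
    define a where "a = i\<^sub>0 - 2 * D"
    define b where "b = min (i\<^sub>0 + 2 * D) (d y z)"
    have ab: "a \<le> i\<^sub>0" "i\<^sub>0 \<le> b" "b \<le> d y z" "i\<^sub>0 \<le> a + 2 * D" "b \<le> i\<^sub>0 + 2 * D"
      unfolding a_def b_def using i0(1) by auto
    have "d p (h a) = 2 * D \<or> h a \<in> ?N"
    proof (cases "2 * D \<le> i\<^sub>0")
      case True
      then show ?thesis using hp[of a] ab unfolding a_def by auto
    next
      case False
      then show ?thesis using geod_start[OF h] \<open>y \<in> ?N\<close> unfolding a_def by simp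
    qed
    then obtain u where u: "u \<in> ?N" "edge_path V d (\<lambda>v. D \<le> d p v) D (h a) u" "d (h a) u \<le> D"
      using reach[of a] ab by auto
    have "d p (h b) = 2 * D \<or> h b \<in> ?N"
    proof (cases "i\<^sub>0 + 2 * D \<le> d y z")
      case True
      then show ?thesis using hp[of b] unfolding b_def by auto
    next
      case False
      then show ?thesis using geod_end[OF h, of b] \<open>z \<in> ?N\<close> unfolding b_def by simp
    qed
    then obtain v where v: "v \<in> ?N" "edge_path V d (\<lambda>v. D \<le> d p v) D (h b) v" "d (h b) v \<le> D"
      using reach[of b] ab by auto
    have uv: "d u v \<le> 6 * D"
    proof -
      have "d u v \<le> d u (h a) + d (h a) v" "d (h a) v \<le> d (h a) (h b) + d (h b) v"
        using dist_tri V NV u(1) v(1) by blast+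
      moreover have "d u (h a) = d (h a) u" using dist_sym V NV u(1) by blast
      moreover have "d (h a) (h b) + a = b" using geod_dist[OF h, of a b] ab by simp
      ultimately show ?thesis using u(3) v(3) ab by linarith
    qed
    have away: "D - (\<theta> + 2) \<le> d p w" if w: "w \<in> V" "\<exists>u\<in>?N. d w u \<le> \<theta> + 2" for w
    proof -
      obtain u where "u \<in> ?N" "d w u \<le> \<theta> + 2" using w by blast
      then show ?thesis using p_far[of u] dist_tri[OF pV w(1) NV[of u]] by fastforce
    qed
    have "edge_path V d (\<lambda>v. D - (\<theta> + 2) \<le> d p v) (D + ((5 * d u v + C) + D)) (h a) (h b)"
    proof (rule edge_path_trans[OF _ edge_path_trans])
      show "edge_path V d (\<lambda>v. D - (\<theta> + 2) \<le> d p v) D (h a) u"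
        by (rule edge_path_mono[OF u(2)]) auto
      show "edge_path V d (\<lambda>v. D - (\<theta> + 2) \<le> d p v) (5 * d u v + C) u v"
        by (rule edge_path_mono[OF C[OF f g u(1) v(1)]]) (use away in auto)
      show "edge_path V d (\<lambda>v. D - (\<theta> + 2) \<le> d p v) D v (h b)"
        by (rule edge_path_mono[OF edge_path_sym[OF v(2)]]) auto
    qed
    then have path: "edge_path V d (\<lambda>v. D - (\<theta> + 2) \<le> d p v) (32 * D + C) (h a) (h b)"
      by (rule edge_path_mono) (use uv in auto)
    have "D \<le> S + H"
    proof (rule ccontr)
      assume "\<not> D \<le> S + H"
      then have big: "S + H < D" by simp
      define s where "s = D - H"
      have D: "D = s + H" unfolding s_def using big by simp
      have D1: "Suc \<theta> \<le> D" unfolding D H_def by simp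
      define k where "k = s div r\<^sub>0"
      have "k * r\<^sub>0 \<le> s" unfolding k_def by (rule div_times_less_eq_dividend)
      then have radius: "Suc \<theta> + k * r\<^sub>0 \<le> D - (\<theta> + 2)" unfolding D H_def by simp
      have A: "geod (\<lambda>t. h (max a (i\<^sub>0 - t))) p (h a)"
        unfolding p_def by (rule geod_sub_rev[OF h]) (use ab i0 in auto)
      have B: "geod (\<lambda>t. h (min (i\<^sub>0 + t) b)) p (h b)"
        unfolding p_def by (rule geod_sub[OF h]) (use ab in auto)
      have "max a (i\<^sub>0 - Suc \<theta>) = i\<^sub>0 - Suc \<theta>" unfolding a_def using D1 by simp
      moreover have "min (i\<^sub>0 + Suc \<theta>) b = i\<^sub>0 + Suc \<theta>" unfolding b_def using D1 Dr by simp
      moreover have "d (h (i\<^sub>0 - Suc \<theta>)) (h (i\<^sub>0 + Suc \<theta>)) + (i\<^sub>0 - Suc \<theta>) = i\<^sub>0 + Suc \<theta>"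
        by (rule geod_dist[OF h]) (use D1 Dr in auto)
      ultimately have
        "\<theta> < d (h (max a (i\<^sub>0 - Suc \<theta>))) (h (min (i\<^sub>0 + Suc \<theta>) b))"
        using D1 Dl by simp
      moreover have "edge_path V d (\<lambda>v. Suc \<theta> + k * r\<^sub>0 \<le> d p v) (32 * D + C) (h a) (h b)"
        by (rule edge_path_mono[OF path order_refl]) (use radius in linarith)
      ultimately have "2 ^ k \<le> 32 * D + C" using exponential_divergence[OF A B] by blast
      then have "2 ^ (s div r\<^sub>0) \<le> 32 * s + (32 * H + C)" unfolding k_def D by simp
      then have "s < S" by (rule S)
      then show False using big D by simp
    qed
    then show ?thesis using near[of i] le_trans by blast
  qed
  then show ?thesis by blast
qed

section \<open>Gromov hyperbolicity\<close>

text \<open>A point \<open>w\<close> for which the detour from \<open>u\<close> to \<open>v\<close> through \<open>w\<close> is at most \<open>c\<close> longer than a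
  geodesic is close to every geodesic from \<open>u\<close> to \<open>v\<close>: this geodesic passes from the neighbourhood
  of one side of the triangle \<open>u, w, v\<close> to that of the other side, and there both sides are near
  \<open>w\<close>.\<close>
lemma near_geodesic:
  "\<exists>N. \<forall>u v w g. geod g u v \<longrightarrow> w \<in> V \<longrightarrow> d u w + d w v \<le> d u v + c \<longrightarrow> d w (g (d u w)) \<le> N"
proof -
  obtain D where D: "\<And>x y z f g h i. \<lbrakk>geod f x y; geod g x z; geod h y z\<rbrakk> \<Longrightarrow>
     \<exists>u \<in> range f \<union> range g. d (h i) u \<le> D"
    using thin_triangles by blast
  define N where "N = 3 * D + 1 + c"
  have "d w (g (d u w)) \<le> 2 * N"
    if g: "geod g u v" and w: "w \<in> V" and ex: "d u w + d w v \<le> d u v + c" for u v w g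
  proof -
    have V: "u \<in> V" "v \<in> V" "\<And>i. g i \<in> V" using geod_ends_in geod_in g by blast+
    obtain f where f: "geod f w u" using geodesic_exists w V by blast
    obtain h where h: "geod h w v" using geodesic_exists w V by blast
    have fh: "\<And>i. f i \<in> V" "\<And>i. h i \<in> V" using geod_in f h by blast+
    let ?P = "\<lambda>i. i \<le> d u v \<and> (\<exists>j\<le>d w u. d (g i) (f j) \<le> D)"
    have "?P 0" using geod_start[OF g] geod_end[OF f, of "d w u"] dist_self[OF V(1)] by auto
    define i where "i = (GREATEST i. ?P i)"
    have Pi: "?P i" unfolding i_def by (rule GreatestI_nat[of ?P 0 "d u v"]) (use \<open>?P 0\<close> in auto)
    have gt: "\<not> ?P (Suc i)"
      using Greatest_le_nat[of ?P "Suc i" "d u v"] unfolding i_def by auto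
    obtain j where j: "j \<le> d w u" "d (g i) (f j) \<le> D" using Pi by blast
    have "\<exists>l\<le>d w v. d (g i) (h l) \<le> D + 1"
    proof (cases "i = d u v")
      case True
      then have "d (g i) (h (d w v)) = 0"
        using geod_end[OF g, of i] geod_end[OF h, of "d w v"] dist_self[OF V(2)] by simp
      then show ?thesis by (intro exI[of _ "d w v"]) simp
    next
      case False
      obtain q where q: "q \<in> range f \<union> range h" "d (g (Suc i)) q \<le> D" using D[OF f h g] by blast
      have "q \<notin> range f"
      proof
        assume "q \<in> range f"
        then obtain t where "q = f t" by blast
        then have "q = f (min t (d w u))" using geod_clip[OF f, of t] by simp
        then have "?P (Suc i)" using q(2) False Pi
          by (intro conjI exI[of _ "min t (d w u)"]) auto
        then show False using gt by blast
      qed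
      then obtain t where "q = h t" using q(1) by blast
      then have t: "d (g (Suc i)) (h (min t (d w v))) \<le> D" using geod_clip[OF h, of t] q(2) by simp
      have "d (g i) (h (min t (d w v))) \<le> d (g i) (g (Suc i)) + d (g (Suc i)) (h (min t (d w v)))"
        using dist_tri V fh by blast
      then show ?thesis using t geod_lipschitz[OF g, of i "Suc i"]
        by (intro exI[of _ "min t (d w v)"]) auto
    qed
    then obtain l where l: "l \<le> d w v" "d (g i) (h l) \<le> D + 1" by blast
    have 1: "d w (f j) + d (f j) u = d w u" "d w (h l) + d (h l) v = d w v"
      using geod_dist_start[OF f j(1)] geod_dist_end[OF f j(1)] geod_dist_start[OF h l(1)]
        geod_dist_end[OF h l(1)] by linarith+
    have 2: "d u v \<le> d u (f j) + d (f j) v" "d (f j) v \<le> d (f j) (h l) + d (h l) v"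
      "d (f j) (h l) \<le> d (f j) (g i) + d (g i) (h l)" "d w (g i) \<le> d w (f j) + d (f j) (g i)"
      using dist_tri V fh w by blast+
    have 3: "d u (f j) = d (f j) u" "d u w = d w u" "d (f j) (g i) = d (g i) (f j)"
      using dist_sym V fh w by blast+
    have wN: "d w (g i) \<le> N" unfolding N_def using 1 2 3 j l ex by linarith
    have ui: "d u (g i) = i" using geod_dist_start[OF g] Pi by blast
    have "d u w \<le> d u (g i) + d (g i) w" "d u (g i) \<le> d u w + d w (g i)" "d (g i) w = d w (g i)"
      using dist_tri dist_sym V w by blast+
    then have close: "d u w \<le> i + N" "i \<le> d u w + N" using ui wN by linarith+
    have "d (g i) (g (d u w)) \<le> N"
      using geod_lipschitz[OF g, of i "d u w"] geod_lipschitz'[OF g, of "d u w" i] close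
      by (cases "i \<le> d u w") auto
    moreover have "d w (g (d u w)) \<le> d w (g i) + d (g i) (g (d u w))"
      using dist_tri V w by blast
    ultimately show ?thesis using wN by linarith
  qed
  then show ?thesis by blast
qed

text \<open>The images under \<open>\<nu>\<close> of the points of a geodesic segment have detour at most 6, hence the
  segment and a discrete geodesic between the images of its ends are close to each other, and
  thinness of discrete triangles carries over. No metric axioms for \<open>dX\<close> are needed.\<close>
theorem gromov_hyperbolic_if_roughly_isometric:
  fixes X :: "'p set" and dX :: "'p \<Rightarrow> 'p \<Rightarrow> real" and \<nu> :: "'p \<Rightarrow> 'v"
  assumes \<nu>: "\<And>p. p \<in> X \<Longrightarrow> \<nu> p \<in> V"
    and rough: "\<And>p q. \<lbrakk>p \<in> X; q \<in> X\<rbrakk> \<Longrightarrow> \<bar>dX p q - real (d (\<nu> p) (\<nu> q))\<bar> \<le> 2"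
  shows "gromov_hyperbolic X dX"
proof -
  obtain D where D: "\<And>x y z f g h i. \<lbrakk>geod f x y; geod g x z; geod h y z\<rbrakk> \<Longrightarrow>
     \<exists>u \<in> range f \<union> range g. d (h i) u \<le> D"
    using thin_triangles by blast
  obtain N where N: "\<And>u v w g. \<lbrakk>geod g u v; w \<in> V; d u w + d w v \<le> d u v + 6\<rbrakk> \<Longrightarrow>
     d w (g (d u w)) \<le> N"
    using near_geodesic by blast
  have seg: "(\<forall>p\<in>S. d (\<nu> p) (g (d (\<nu> x) (\<nu> p))) \<le> N) \<and> (\<forall>i. \<exists>q\<in>S. d (\<nu> q) (g i) \<le> N + 4)"
    if S: "geodesic_segment X dX x y S" and g: "geod g (\<nu> x) (\<nu> y)" for x y S g
  proof -
    obtain L \<sigma> where *: "0 \<le> L \<and> \<sigma> 0 = x \<and> \<sigma> L = y \<and> S = \<sigma> ` {0..L} \<and> S \<subseteq> X \<and>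
        (\<forall>s \<in> {0..L}. \<forall>t \<in> {0..L}. dX (\<sigma> s) (\<sigma> t) = \<bar>s - t\<bar>)"
      using S unfolding geodesic_segment_def by (elim exE)
    then have L: "0 \<le> L" "\<sigma> 0 = x" "\<sigma> L = y" "S = \<sigma> ` {0..L}" "S \<subseteq> X" by blast+
    have iso: "dX (\<sigma> s) (\<sigma> t) = \<bar>s - t\<bar>" if "s \<in> {0..L}" "t \<in> {0..L}" for s t
      using * that by blast
    have X: "\<sigma> s \<in> X" if "s \<in> {0..L}" for s using that L by blast
    have r: "\<bar>\<bar>s - t\<bar> - real (d (\<nu> (\<sigma> s)) (\<nu> (\<sigma> t)))\<bar> \<le> 2" if "s \<in> {0..L}" "t \<in> {0..L}" for s t
      using rough[OF X[OF that(1)] X[OF that(2)]] iso[OF that] by simp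
    have 0: "0 \<in> {0..L}" "L \<in> {0..L}" using L by auto
    have near: "d (\<nu> (\<sigma> s)) (g (d (\<nu> x) (\<nu> (\<sigma> s)))) \<le> N" if s: "s \<in> {0..L}" for s
    proof (rule N[OF g \<nu>[OF X[OF s]]])
      show "d (\<nu> x) (\<nu> (\<sigma> s)) + d (\<nu> (\<sigma> s)) (\<nu> y) \<le> d (\<nu> x) (\<nu> y) + 6"
        using r[OF 0(1) s] r[OF s 0(2)] r[OF 0] s unfolding L(2,3) by auto
    qed
    have "\<exists>q\<in>S. d (\<nu> q) (g i) \<le> N + 4" for i
    proof -
      define j where "j = min i (d (\<nu> x) (\<nu> y))"
      have gj: "g i = g j" unfolding j_def by (rule geod_clip[OF g])
      define s where "s = min (real j) L"
      have s: "s \<in> {0..L}" using L(1) unfolding s_def by auto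
      define t where "t = d (\<nu> x) (\<nu> (\<sigma> s))"
      have jl: "real j \<le> L + 2" using r[OF 0] L(1) unfolding L(2,3) j_def by linarith
      have "real t \<le> s + 2" "s \<le> real t + 2"
        using r[OF 0(1) s] s unfolding L(2) t_def by auto
      then have tj: "t \<le> j + 4" "j \<le> t + 4" using jl unfolding s_def by linarith+
      have V: "\<nu> (\<sigma> s) \<in> V" "\<And>i. g i \<in> V" using geod_in[OF g] \<nu>[OF X[OF s]] by auto
      have "d (g t) (g j) \<le> 4"
        using geod_lipschitz[OF g, of t j] geod_lipschitz'[OF g, of j t] tj
        by (cases "t \<le> j") auto
      moreover have "d (\<nu> (\<sigma> s)) (g j) \<le> d (\<nu> (\<sigma> s)) (g t) + d (g t) (g j)"
        using dist_tri V by blast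
      ultimately have "d (\<nu> (\<sigma> s)) (g j) \<le> N + 4" using near[OF s] unfolding t_def by linarith
      then show ?thesis using s L(4) gj by auto
    qed
    then show ?thesis using near L(4) by auto
  qed
  have ends: "x \<in> X" "y \<in> X" if seg: "geodesic_segment X dX x y S" for x y S
  proof -
    obtain L \<sigma> where *: "0 \<le> L \<and> \<sigma> 0 = x \<and> \<sigma> L = y \<and> S = \<sigma> ` {0..L} \<and> S \<subseteq> X \<and>
        (\<forall>s \<in> {0..L}. \<forall>t \<in> {0..L}. dX (\<sigma> s) (\<sigma> t) = \<bar>s - t\<bar>)"
      using seg unfolding geodesic_segment_def by (elim exE)
    then have "0 \<in> {0..L}" "L \<in> {0..L}" by simp_all
    then show "x \<in> X" "y \<in> X" using * by blast+
  qed
  have sub: "S \<subseteq> X" if "geodesic_segment X dX x y S" for x y S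
    using that unfolding geodesic_segment_def by (elim exE conjE)
  define \<delta> where "\<delta> = N + D + (N + 4) + 2"
  have "\<exists>q \<in> S\<^sub>2 \<union> S\<^sub>3. dX p q \<le> real \<delta>"
    if S: "geodesic_segment X dX x y S\<^sub>1" "geodesic_segment X dX y z S\<^sub>2"
      "geodesic_segment X dX z x S\<^sub>3" and p: "p \<in> S\<^sub>1" for x y z S\<^sub>1 S\<^sub>2 S\<^sub>3 p
  proof -
    have X: "x \<in> X" "y \<in> X" "z \<in> X" using ends S by blast+
    have \<nu>V: "\<nu> x \<in> V" "\<nu> y \<in> V" "\<nu> z \<in> V" using \<nu> X by simp_all
    obtain g1 where g1: "geod g1 (\<nu> x) (\<nu> y)" using geodesic_exists[OF \<nu>V(1,2)] by blast
    obtain g2 where g2: "geod g2 (\<nu> y) (\<nu> z)" using geodesic_exists[OF \<nu>V(2,3)] by blast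
    obtain g3 where g3: "geod g3 (\<nu> z) (\<nu> x)" using geodesic_exists[OF \<nu>V(3,1)] by blast
    note g = g1 g2 g3
    obtain i where i: "d (\<nu> p) (g1 i) \<le> N" using seg[OF S(1) g(1)] p by blast
    obtain u where u: "u \<in> range g3 \<union> range (\<lambda>i. g2 (d (\<nu> y) (\<nu> z) - i))" "d (g1 i) u \<le> D"
      using D[OF g(3) geod_reverse[OF g(2)] g(1)] by blast
    have "\<exists>q \<in> S\<^sub>2 \<union> S\<^sub>3. d (\<nu> q) u \<le> N + 4"
      using u(1) seg[OF S(2) g(2)] seg[OF S(3) g(3)] by blast
    then obtain q where q: "q \<in> S\<^sub>2 \<union> S\<^sub>3" "d (\<nu> q) u \<le> N + 4" by blast
    have pq: "p \<in> X" "q \<in> X" using sub S p q(1) by blast+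
    have V: "\<nu> p \<in> V" "\<nu> q \<in> V" "g1 i \<in> V" "u \<in> V"
      using \<nu> pq geod_in g u(1) by blast+
    have "d (\<nu> p) (\<nu> q) \<le> d (\<nu> p) (g1 i) + d (g1 i) (\<nu> q)"
      "d (g1 i) (\<nu> q) \<le> d (g1 i) u + d u (\<nu> q)" "d u (\<nu> q) = d (\<nu> q) u"
      using dist_tri dist_sym V by blast+
    then have "d (\<nu> p) (\<nu> q) \<le> N + D + (N + 4)" using i u(2) q(2) by linarith
    then have "dX p q \<le> real \<delta>" using rough[OF pq] unfolding \<delta>_def by auto
    then show ?thesis using q(1) by blast
  qed
  then show ?thesis
    unfolding gromov_hyperbolic_def by (intro exI[of _ "real \<delta>"]) (auto simp: \<delta>_def)
qed

end

section \<open>The word metric and the Cayley graph\<close>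

text \<open>A group with a finite symmetric generating set; that \<open>A\<close> generates the group is expressed by
  surjectivity of evaluation of words.\<close>
locale cayley_graph = group G for G :: "('a, 'm) monoid_scheme" (structure) +
  fixes A :: "'a set"
  assumes gens_closed: "A \<subseteq> carrier G"
    and finite_gens: "finite A"
    and gens_inv: "m_inv G ` A = A"
    and words_onto: "carrier G \<subseteq> word_eval G ` lists A"
begin

abbreviation "wd \<equiv> word_dist G A"
abbreviation "ev \<equiv> word_eval G"

lemma ev_simps [simp]: "ev [] = \<one>" "ev (a # w) = a \<otimes> ev w"
  by (simp_all add: word_eval_def)

lemma ev_closed: "w \<in> lists A \<Longrightarrow> ev w \<in> carrier G"
  by (induction w) (use gens_closed in auto)

lemma ev_append: "v \<in> lists A \<Longrightarrow> w \<in> lists A \<Longrightarrow> ev (v @ w) = ev v \<otimes> ev w"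
proof (induction v)
  case (Cons a v)
  then have "a \<in> carrier G" "ev v \<in> carrier G" "ev w \<in> carrier G" using gens_closed ev_closed by auto
  then show ?case using Cons by (simp add: m_assoc)
qed (use ev_closed in simp)

lemma inv_gen: "a \<in> A \<Longrightarrow> inv a \<in> A"
  using gens_inv by blast

lemma ev_inverse_word:
  assumes "w \<in> lists A"
  shows "rev (map (m_inv G) w) \<in> lists A" "ev (rev (map (m_inv G) w)) = inv (ev w)"
proof -
  have 1: "rev (map (m_inv G) w) \<in> lists A" if "w \<in> lists A" for w
    using that inv_gen by auto
  then show "rev (map (m_inv G) w) \<in> lists A" using assms by blast
  show "ev (rev (map (m_inv G) w)) = inv (ev w)"
    using assms
  proof (induction w)
    case (Cons a w)
    then have a: "a \<in> A" "a \<in> carrier G" "inv a \<in> A" "w \<in> lists A" using gens_closed inv_gen by auto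
    then have "ev (rev (map (m_inv G) w) @ [inv a]) = inv (ev w) \<otimes> inv a"
      using 1[of w] Cons by (subst ev_append) auto
    also have "\<dots> = inv (a \<otimes> ev w)" using a ev_closed by (simp add: inv_mult_group)
    finally show ?case by simp
  qed simp
qed

lemma wd_le:
  assumes "w \<in> lists A" "g \<otimes> ev w = h"
  shows "wd g h \<le> length w"
  unfolding word_dist_def by (rule Least_le) (use assms in blast)

lemma wd_word:
  assumes "g \<in> carrier G" "h \<in> carrier G"
  obtains w where "w \<in> lists A" "length w = wd g h" "g \<otimes> ev w = h"
proof -
  have "inv g \<otimes> h \<in> carrier G" using assms by simp
  then obtain w where w: "w \<in> lists A" "inv g \<otimes> h = ev w" using words_onto by blast
  have "g \<otimes> ev w = h" using assms by (simp flip: w(2) m_assoc)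
  then have "\<exists>k. \<exists>w \<in> lists A. length w = k \<and> g \<otimes> ev w = h" using w by blast
  then have "\<exists>w \<in> lists A. length w = wd g h \<and> g \<otimes> ev w = h"
    unfolding word_dist_def by (rule LeastI_ex)
  then show ?thesis using that by blast
qed

lemma wd_translate:
  assumes "c \<in> carrier G" "g \<in> carrier G" "h \<in> carrier G"
  shows "wd (c \<otimes> g) (c \<otimes> h) = wd g h"
proof -
  have "c \<otimes> g \<otimes> ev w = c \<otimes> h \<longleftrightarrow> g \<otimes> ev w = h" if "w \<in> lists A" for w
    using assms ev_closed[OF that] by (simp add: m_assoc)
  then have "(\<exists>w \<in> lists A. length w = k \<and> c \<otimes> g \<otimes> ev w = c \<otimes> h) \<longleftrightarrow>
      (\<exists>w \<in> lists A. length w = k \<and> g \<otimes> ev w = h)" for k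
    by blast
  then show ?thesis unfolding word_dist_def by simp
qed

lemma wd_refl: "g \<in> carrier G \<Longrightarrow> wd g g = 0"
  using wd_le[of "[]" g g] by simp

lemma wd_triangle:
  assumes "g \<in> carrier G" "h \<in> carrier G" "k \<in> carrier G"
  shows "wd g k \<le> wd g h + wd h k"
proof -
  obtain v where v: "v \<in> lists A" "length v = wd g h" "g \<otimes> ev v = h" using wd_word assms by metis
  obtain w where w: "w \<in> lists A" "length w = wd h k" "h \<otimes> ev w = k" using wd_word assms by metis
  have "g \<otimes> ev (v @ w) = k"
    using v w assms ev_closed by (simp add: ev_append flip: m_assoc)
  then show ?thesis using wd_le[of "v @ w" g k] v w by simp
qed

lemma wd_sym_le:
  assumes "g \<in> carrier G" "h \<in> carrier G"
  shows "wd h g \<le> wd g h"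
proof -
  obtain v where v: "v \<in> lists A" "length v = wd g h" "g \<otimes> ev v = h" using wd_word assms by metis
  have "h \<otimes> ev (rev (map (m_inv G) v)) = g"
    using v(1) assms ev_closed[OF v(1)] unfolding v(3)[symmetric]
    by (simp add: ev_inverse_word m_assoc)
  then show ?thesis using wd_le ev_inverse_word(1)[OF v(1)] v(2) by fastforce
qed

lemma wd_le_1:
  assumes "g \<in> carrier G" "h \<in> carrier G" "wd g h \<le> 1"
  shows "\<exists>x \<in> A \<union> {\<one>}. g \<otimes> x = h"
proof -
  obtain w where w: "w \<in> lists A" "length w = wd g h" "g \<otimes> ev w = h" using wd_word assms by metis
  have "length w \<le> 1" using w(2) assms(3) by simp
  then consider "w = []" | a where "w = [a]" "a \<in> A"
    using w(1) by (cases w) auto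
  then show ?thesis
  proof cases
    case 2
    then have "g \<otimes> a = h" using w(3) gens_closed by auto
    then show ?thesis using 2 by blast
  qed (use w assms in auto)
qed

lemma word_geodesic:
  assumes g: "g \<in> carrier G" and w: "w \<in> lists A" and min: "wd g (g \<otimes> ev w) = length w"
  shows "geodesic_path (carrier G) wd (\<lambda>i. g \<otimes> ev (take i w)) g (g \<otimes> ev w)"
proof -
  have tk: "take i w \<in> lists A" "drop i w \<in> lists A" for i
    using w by (auto dest: in_set_takeD in_set_dropD)
  have cl: "g \<otimes> ev (take i w) \<in> carrier G" for i using g ev_closed tk by simp
  have step: "wd (g \<otimes> ev (take i w)) (g \<otimes> ev (take j w)) \<le> j - i" if "i \<le> j" for i j
  proof -
    have 1: "take j w = take i w @ take (j - i) (drop i w)"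
      using that by (metis le_add_diff_inverse take_add)
    have l: "take (j - i) (drop i w) \<in> lists A" using w by (auto dest: in_set_takeD in_set_dropD)
    have "g \<otimes> ev (take i w) \<otimes> ev (take (j - i) (drop i w)) = g \<otimes> ev (take j w)"
      unfolding 1 using g tk l ev_closed by (simp add: ev_append m_assoc)
    from wd_le[OF l this] show ?thesis by simp
  qed
  have "wd (g \<otimes> ev (take i w)) (g \<otimes> ev (take j w)) + i = j" if "i \<le> j" "j \<le> length w" for i j
  proof -
    have "wd g (g \<otimes> ev (take i w)) \<le> i" using step[of 0 i] g by simp
    moreover have "wd (g \<otimes> ev (take j w)) (g \<otimes> ev w) \<le> length w - j" using step[OF that(2)] by simp
    moreover have "wd g (g \<otimes> ev w) \<le> wd g (g \<otimes> ev (take i w)) + wd (g \<otimes> ev (take i w)) (g \<otimes> ev w)"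
      using wd_triangle g cl[of i] cl[of "length w"] by simp
    moreover have "wd (g \<otimes> ev (take i w)) (g \<otimes> ev w) \<le>
        wd (g \<otimes> ev (take i w)) (g \<otimes> ev (take j w)) + wd (g \<otimes> ev (take j w)) (g \<otimes> ev w)"
      using wd_triangle cl[of i] cl[of j] cl[of "length w"] by simp
    ultimately show ?thesis using step[OF that(1)] that min by linarith
  qed
  then show ?thesis
    unfolding geodesic_path_def using cl g min by auto
qed

end

sublocale cayley_graph \<subseteq> graph_metric "carrier G" "word_dist G A"
proof
  fix x y z assume V: "x \<in> carrier G" "y \<in> carrier G" "z \<in> carrier G"
  show "wd x z \<le> wd x y + wd y z" using wd_triangle V by blast
next
  fix x y assume V: "x \<in> carrier G" "y \<in> carrier G"
  show "wd x y = wd y x" using wd_sym_le V by (simp add: le_antisym)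
  obtain w where w: "w \<in> lists A" "length w = wd x y" "x \<otimes> ev w = y" using wd_word V by metis
  show "wd x y = 0 \<longleftrightarrow> x = y" using w wd_refl V by auto
  show "\<exists>f. geodesic_path (carrier G) wd f x y" using word_geodesic[OF V(1) w(1)] w by auto
qed

context cayley_graph
begin

lemma geod_translate:
  assumes "geod f x y" "c \<in> carrier G"
  shows "geod (\<lambda>i. c \<otimes> f i) (c \<otimes> x) (c \<otimes> y)"
proof -
  have V: "x \<in> carrier G" "y \<in> carrier G" "\<And>i. f i \<in> carrier G"
    using geod_in geod_ends_in assms(1) by blast+
  then show ?thesis
    using assms(1) wd_translate[OF assms(2)] assms(2) unfolding geodesic_path_def by auto
qed

lemma ball_card_bound:
  "\<exists>B. \<forall>g \<in> carrier G. finite {h \<in> carrier G. wd g h \<le> r} \<and> card {h \<in> carrier G. wd g h \<le> r} \<le> B"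
proof -
  define S where "S = {w \<in> lists A. length w \<le> r}"
  have S: "finite S" unfolding S_def using finite_lists_length_le[OF finite_gens, of r]
    by (simp add: lists_eq_set)
  have "finite {h \<in> carrier G. wd g h \<le> r} \<and> card {h \<in> carrier G. wd g h \<le> r} \<le> card S"
    if g: "g \<in> carrier G" for g
  proof -
    have sub: "{h \<in> carrier G. wd g h \<le> r} \<subseteq> (\<lambda>w. g \<otimes> ev w) ` S"
    proof
      fix h assume h: "h \<in> {h \<in> carrier G. wd g h \<le> r}"
      then obtain w where "w \<in> lists A" "length w = wd g h" "g \<otimes> ev w = h"
        using wd_word[OF g, of h] by blast
      then show "h \<in> (\<lambda>w. g \<otimes> ev w) ` S" using h unfolding S_def by force
    qed
    then show ?thesis
      using finite_subset[OF sub] surj_card_le[OF S sub] S by blast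
  qed
  then show ?thesis by blast
qed

text \<open>The initial vertex of the edge that carries a point; it is at distance less than 1 from the
  point.\<close>
fun base_vertex :: "'a cayley_point \<Rightarrow> 'a" where
  "base_vertex (Vertex g) = g"
| "base_vertex (Inner g a s) = g"

lemma cayley_dist_rough:
  assumes p: "p \<in> cayley_points G A" and q: "q \<in> cayley_points G A"
  shows "\<bar>cayley_dist G A p q - real (wd (base_vertex p) (base_vertex q))\<bar> \<le> 2"
proof -
  have base: "base_vertex p \<in> carrier G" if "p \<in> cayley_points G A" for p
    using that unfolding cayley_points_def by auto
  have ends: "u \<in> carrier G \<and> 0 \<le> \<alpha> \<and> real (wd (base_vertex p) u) \<le> \<alpha> + 1 \<and> \<alpha> \<le> 1"
    if "p \<in> cayley_points G A" "(u, \<alpha>) \<in> point_ends G p" for p u \<alpha>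
  proof (cases p)
    case (Vertex g)
    then show ?thesis using that base[OF that(1)] wd_refl by simp
  next
    case (Inner g a s)
    then have g: "g \<in> carrier G" "a \<in> A" "0 < s" "s < 1" using that(1) unfolding cayley_points_def by auto
    then have "wd g (g \<otimes> a) \<le> 1" using wd_le[of "[a]" g "g \<otimes> a"] gens_closed by auto
    then show ?thesis using that(2) g gens_closed wd_refl[OF g(1)] unfolding Inner by auto
  qed
  have at_base: "\<exists>\<alpha>. (base_vertex p, \<alpha>) \<in> point_ends G p" for p by (cases p) auto
  have fin: "finite (point_ends G p)" "finite (edge_route p q)" for p q
    by (cases p; simp) (cases "(p, q)" rule: edge_route.cases; simp)
  define n where "n = wd (base_vertex p) (base_vertex q)"
  define R where "R = (\<lambda>((u, \<alpha>), (v, \<beta>)). \<alpha> + real (wd u v) + \<beta>) ` (point_ends G p \<times> point_ends G q)"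
  have R: "cayley_dist G A p q = Min (R \<union> edge_route p q)"
    unfolding cayley_dist_def R_def ..
  have finR: "finite (R \<union> edge_route p q)" unfolding R_def using fin by simp
  obtain \<alpha> \<beta> where ab: "(base_vertex p, \<alpha>) \<in> point_ends G p" "(base_vertex q, \<beta>) \<in> point_ends G q"
    using at_base by meson
  have inR: "\<alpha> + real n + \<beta> \<in> R"
    unfolding R_def n_def by (rule image_eqI[of _ _ "((base_vertex p, \<alpha>), (base_vertex q, \<beta>))"]) (use ab in auto)
  have "Min (R \<union> edge_route p q) \<le> \<alpha> + real n + \<beta>" using finR inR by (intro Min_le) auto
  then have upper: "Min (R \<union> edge_route p q) \<le> real n + 2" using ends[OF p ab(1)] ends[OF q ab(2)] by linarith
  have "real n - 2 \<le> r" if r: "r \<in> R \<union> edge_route p q" for r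
  proof (cases "r \<in> R")
    case True
    then obtain u v \<mu> \<nu> where uv: "(u, \<mu>) \<in> point_ends G p" "(v, \<nu>) \<in> point_ends G q"
      "r = \<mu> + real (wd u v) + \<nu>"
      unfolding R_def by auto
    note e = ends[OF p uv(1)] ends[OF q uv(2)]
    have "wd (base_vertex p) (base_vertex q) \<le> wd (base_vertex p) u + wd u (base_vertex q)"
      "wd u (base_vertex q) \<le> wd u v + wd v (base_vertex q)"
      "wd v (base_vertex q) = wd (base_vertex q) v"
      using wd_triangle[of "base_vertex p" u "base_vertex q"] wd_triangle[of u v "base_vertex q"]
        dist_sym[of v "base_vertex q"] base[OF p] base[OF q] e by simp_all
    then have "real n \<le> real (wd (base_vertex p) u) + real (wd u v) + real (wd (base_vertex q) v)"
      unfolding n_def by linarith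
    then show ?thesis using e uv(3) by linarith
  next
    case False
    then have "r \<in> edge_route p q" using r by blast
    then have "0 \<le> r \<and> base_vertex p = base_vertex q"
      by (cases "(p, q)" rule: edge_route.cases) (auto split: if_splits)
    moreover from this have "n = 0" using wd_refl[OF base[OF p]] unfolding n_def by simp
    ultimately show ?thesis by simp
  qed
  then have "real n - 2 \<le> Min (R \<union> edge_route p q)" using finR inR by (intro Min.boundedI) auto
  then show ?thesis using upper unfolding R n_def by linarith
qed

end

section \<open>Synchronous fellow travelling\<close>

lemma pad_pair_append:
  "length u = length u' \<Longrightarrow> pad_pair (u @ v) (u' @ v') = pad_pair u u' @ pad_pair v v'"
  by (simp add: pad_pair_def zip_append)

lemma pad_pair_alphabet:
  assumes "w \<in> lists A" "w' \<in> lists A"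
  shows "pad_pair w w' \<in> lists (padded_alphabet A)"
proof -
  have "set (map Some v @ replicate m None) \<subseteq> insert None (Some ` A)" if "v \<in> lists A" for v m
    using that by auto
  then have "(x, y) \<in> padded_alphabet A" if "(x, y) \<in> set (pad_pair w w')" for x y
    using assms set_zip_leftD[OF that[unfolded pad_pair_def]]
      set_zip_rightD[OF that[unfolded pad_pair_def]]
    unfolding padded_alphabet_def by blast
  then show ?thesis by auto
qed

lemma fsa_run_in_states:
  assumes "fsa_over \<Sigma> D" "q \<in> fsa_states D" "w \<in> lists \<Sigma>"
  shows "foldl (fsa_next D) q w \<in> fsa_states D"
  using assms(2,3) by (induction w arbitrary: q) (use assms(1) in \<open>auto simp: fsa_over_def\<close>)

locale geodesic_automatic_group = cayley_graph +
  fixes W :: "('p, 'a) fsa" and M :: "'a \<Rightarrow> ('q, 'a option \<times> 'a option) fsa"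
  assumes automatic: "automatic_structure G A W M"
    and geodesic_words: "weakly_geodesic G A (fsa_lang A W)"
    and closed_prefix: "prefix_closed (fsa_lang A W)"
    and unique_words: "uniqueness_property G (fsa_lang A W)"
begin

abbreviation "L \<equiv> fsa_lang A W"

lemma L_lists: "w \<in> L \<Longrightarrow> w \<in> lists A"
  by (simp add: fsa_lang_def)

lemma L_ev: "w \<in> L \<Longrightarrow> ev w \<in> carrier G"
  using L_lists ev_closed by blast

lemma L_take: "w \<in> L \<Longrightarrow> take t w \<in> L"
  using closed_prefix unfolding prefix_closed_def by (cases "t \<le> length w") auto

lemma L_inj: "v \<in> L \<Longrightarrow> w \<in> L \<Longrightarrow> ev v = ev w \<Longrightarrow> v = w"
  using unique_words unfolding uniqueness_property_def by (blast dest: inj_onD)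

lemma L_length: "w \<in> L \<Longrightarrow> wd \<one> (ev w) = length w"
  using geodesic_words unfolding weakly_geodesic_def by blast

text \<open>The accepted word that represents \<open>g\<close>.\<close>
definition nf :: "'a \<Rightarrow> 'a list" where "nf g = inv_into L ev g"

lemma nf_L: "g \<in> carrier G \<Longrightarrow> nf g \<in> L"
  and ev_nf: "g \<in> carrier G \<Longrightarrow> ev (nf g) = g"
proof -
  have "ev ` L = carrier G" using automatic unfolding automatic_structure_def by blast
  then show "g \<in> carrier G \<Longrightarrow> nf g \<in> L" "g \<in> carrier G \<Longrightarrow> ev (nf g) = g"
    unfolding nf_def by (simp_all add: inv_into_into f_inv_into_f)
qed

lemma nf_length: "g \<in> carrier G \<Longrightarrow> length (nf g) = wd \<one> g"
  using L_length nf_L ev_nf by metis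

lemma accepts_iff:
  assumes "x \<in> A \<union> {\<one>}" "w \<in> lists A" "w' \<in> lists A"
  shows "accepts_pair A (M x) w w' \<longleftrightarrow> ev w \<otimes> x = ev w' \<and> w \<in> L \<and> w' \<in> L"
  using automatic assms unfolding automatic_structure_def by blast

lemma M_over: "x \<in> A \<union> {\<one>} \<Longrightarrow> fsa_over (padded_alphabet A) (M x)"
  using automatic unfolding automatic_structure_def by blast

text \<open>The state of the compare automaton \<open>M x\<close> after reading a padded pair.\<close>
definition run :: "'a \<Rightarrow> 'a list \<Rightarrow> 'a list \<Rightarrow> 'q" where
  "run x w w' = foldl (fsa_next (M x)) (fsa_start (M x)) (pad_pair w w')"

lemma run_in_states:
  assumes "x \<in> A \<union> {\<one>}" "w \<in> lists A" "w' \<in> lists A"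
  shows "run x w w' \<in> fsa_states (M x)"
proof -
  show ?thesis
    unfolding run_def using pad_pair_alphabet[OF assms(2,3)] M_over[OF assms(1)]
    by (intro fsa_run_in_states) (simp_all add: fsa_over_def)
qed

text \<open>The continuation of the second pair is accepted after the first pair of prefixes too, as it
  starts from the same state. The pairs of prefixes have equal lengths, so that splicing produces
  correctly padded pairs.\<close>
lemma difference_determined_by_state:
  assumes x: "x \<in> A \<union> {\<one>}"
    and w: "w \<in> L" "w' \<in> L" "ev w \<otimes> x = ev w'" "t \<le> length w" "t \<le> length w'"
    and v: "v \<in> L" "v' \<in> L" "ev v \<otimes> x = ev v'" "s \<le> length v" "s \<le> length v'"
    and same: "run x (take t w) (take t w') = run x (take s v) (take s v')"
  shows "inv (ev (take t w)) \<otimes> ev (take t w') = inv (ev (take s v)) \<otimes> ev (take s v')"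
proof -
  have l: "take t w \<in> lists A" "take t w' \<in> lists A" "drop s v \<in> lists A" "drop s v' \<in> lists A"
     "take s v \<in> lists A" "take s v' \<in> lists A"
    using w v by (auto dest!: L_lists in_set_takeD in_set_dropD)
  have xG: "x \<in> carrier G" using x gens_closed by auto
  have "accepts_pair A (M x) v v'" using accepts_iff[OF x] v L_lists by simp
  moreover have "pad_pair v v' = pad_pair (take s v) (take s v') @ pad_pair (drop s v) (drop s v')"
    using v(4,5) by (simp flip: pad_pair_append)
  moreover have "pad_pair (take t w @ drop s v) (take t w' @ drop s v') =
      pad_pair (take t w) (take t w') @ pad_pair (drop s v) (drop s v')"
    using w(4,5) by (simp add: pad_pair_append)
  moreover have "pad_pair (take t w @ drop s v) (take t w' @ drop s v') \<in> lists (padded_alphabet A)"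
    using l by (intro pad_pair_alphabet) auto
  ultimately have "accepts_pair A (M x) (take t w @ drop s v) (take t w' @ drop s v')"
    using same unfolding accepts_pair_def fsa_lang_def run_def by simp
  then have "ev (take t w @ drop s v) \<otimes> x = ev (take t w' @ drop s v')"
    using accepts_iff[OF x] l by simp
  then have 1: "ev (take t w) \<otimes> ev (drop s v) \<otimes> x = ev (take t w') \<otimes> ev (drop s v')"
    using l by (simp add: ev_append)
  have "ev (take s v @ drop s v) \<otimes> x = ev (take s v' @ drop s v')" using v(3) by simp
  then have 2: "ev (take s v) \<otimes> ev (drop s v) \<otimes> x = ev (take s v') \<otimes> ev (drop s v')"
    by (simp only: ev_append l)
  have key: "inv p \<otimes> p' = a \<otimes> x \<otimes> inv a'"
    if "p \<in> carrier G" "p' \<in> carrier G" "a \<in> carrier G" "a' \<in> carrier G" "p \<otimes> a \<otimes> x = p' \<otimes> a'"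
    for p p' a a'
  proof -
    have "p' = p' \<otimes> a' \<otimes> inv a'" using that by (simp add: m_assoc)
    then have p': "p' = p \<otimes> a \<otimes> x \<otimes> inv a'" unfolding that(5) .
    have "inv p \<otimes> p' = inv p \<otimes> (p \<otimes> (a \<otimes> x \<otimes> inv a'))"
      by (subst p') (use that(1-4) xG in \<open>simp add: m_assoc\<close>)
    also have "\<dots> = a \<otimes> x \<otimes> inv a'" using that(1-4) xG by (simp flip: m_assoc)
    finally show ?thesis .
  qed
  show ?thesis
    using key[OF _ _ _ _ 1] key[OF _ _ _ _ 2] ev_closed l by simp
qed

text \<open>There are finitely many compare automata and states, so only finitely many word differences
  occur. When one of the words has ended, both prefixes are within 1 of the full words.\<close>
lemma fellow_traveller:
  "\<exists>k. \<forall>w \<in> L. \<forall>w' \<in> L. wd (ev w) (ev w') \<le> 1 \<longrightarrow> (\<forall>t. wd (ev (take t w)) (ev (take t w')) \<le> k)"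
proof -
  define P where "P x q \<delta> \<longleftrightarrow> (\<exists>w w' t. w \<in> L \<and> w' \<in> L \<and> ev w \<otimes> x = ev w' \<and> t \<le> length w \<and>
     t \<le> length w' \<and> q = run x (take t w) (take t w') \<and>
     \<delta> = inv (ev (take t w)) \<otimes> ev (take t w'))" for x q \<delta>
  define \<Delta> where "\<Delta> = {\<delta>. \<exists>x \<in> A \<union> {\<one>}. \<exists>q \<in> fsa_states (M x). P x q \<delta>}"
  have "finite {\<delta>. \<exists>q \<in> fsa_states (M x). P x q \<delta>}" if x: "x \<in> A \<union> {\<one>}" for x
  proof (rule finite_subset)
    have uniq: "\<delta>' = \<delta>" if P: "P x q \<delta>" "P x q \<delta>'" for q \<delta> \<delta>'
    proof -
      obtain w w' t where "w \<in> L \<and> w' \<in> L \<and> ev w \<otimes> x = ev w' \<and> t \<le> length w \<and>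
        t \<le> length w' \<and> q = run x (take t w) (take t w') \<and>
        \<delta> = inv (ev (take t w)) \<otimes> ev (take t w')"
        using P(1) unfolding P_def by (elim exE)
      then have w: "w \<in> L" "w' \<in> L" "ev w \<otimes> x = ev w'" "t \<le> length w" "t \<le> length w'"
        "q = run x (take t w) (take t w')" "\<delta> = inv (ev (take t w)) \<otimes> ev (take t w')"
        by simp_all
      obtain v v' s where "v \<in> L \<and> v' \<in> L \<and> ev v \<otimes> x = ev v' \<and> s \<le> length v \<and>
        s \<le> length v' \<and> q = run x (take s v) (take s v') \<and>
        \<delta>' = inv (ev (take s v)) \<otimes> ev (take s v')"
        using P(2) unfolding P_def by (elim exE)
      then have v: "v \<in> L" "v' \<in> L" "ev v \<otimes> x = ev v'" "s \<le> length v" "s \<le> length v'"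
        "q = run x (take s v) (take s v')" "\<delta>' = inv (ev (take s v)) \<otimes> ev (take s v')"
        by simp_all
      have same: "run x (take t w) (take t w') = run x (take s v) (take s v')" using w(6) v(6) by simp
      from difference_determined_by_state[OF x w(1-5) v(1-5) same] show ?thesis
        unfolding w(7) v(7) by (rule sym)
    qed
    have the: "(THE \<delta>. P x q \<delta>) = \<delta>" if "P x q \<delta>" for q \<delta>
      by (rule the_equality[of "P x q"]) (use that uniq in blast)+
    show "{\<delta>. \<exists>q \<in> fsa_states (M x). P x q \<delta>} \<subseteq> (\<lambda>q. THE \<delta>. P x q \<delta>) ` fsa_states (M x)"
    proof
      fix \<delta> assume "\<delta> \<in> {\<delta>. \<exists>q \<in> fsa_states (M x). P x q \<delta>}"
      then obtain q where "q \<in> fsa_states (M x)" "P x q \<delta>" by blast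
      then show "\<delta> \<in> (\<lambda>q. THE \<delta>. P x q \<delta>) ` fsa_states (M x)"
        using the by (intro image_eqI[of _ _ q]) auto
    qed
    show "finite ((\<lambda>q. THE \<delta>. P x q \<delta>) ` fsa_states (M x))"
      using M_over[OF x] unfolding fsa_over_def by simp
  qed
  moreover have "\<Delta> = (\<Union>x \<in> A \<union> {\<one>}. {\<delta>. \<exists>q \<in> fsa_states (M x). P x q \<delta>})"
    unfolding \<Delta>_def by blast
  ultimately have fin: "finite \<Delta>" using finite_gens by simp
  define k where "k = Max (insert 3 (wd \<one> ` \<Delta>))"
  have k3: "3 \<le> k" unfolding k_def using fin by (intro Max_ge) auto
  have k\<Delta>: "wd \<one> \<delta> \<le> k" if "\<delta> \<in> \<Delta>" for \<delta> unfolding k_def using fin that by (intro Max_ge) auto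
  have "wd (ev (take t w)) (ev (take t w')) \<le> k"
    if w: "w \<in> L" "w' \<in> L" and near: "wd (ev w) (ev w') \<le> 1" for w w' t
  proof -
    have V: "ev w \<in> carrier G" "ev w' \<in> carrier G" "ev (take t w) \<in> carrier G"
      "ev (take t w') \<in> carrier G"
      using w L_ev L_take by blast+
    show ?thesis
    proof (cases "t \<le> length w \<and> t \<le> length w'")
      case True
      obtain x where x: "x \<in> A \<union> {\<one>}" "ev w \<otimes> x = ev w'" using wd_le_1 V near by blast
      let ?\<delta> = "inv (ev (take t w)) \<otimes> ev (take t w')"
      have "P x (run x (take t w) (take t w')) ?\<delta>" unfolding P_def using w x True by blast
      moreover have "run x (take t w) (take t w') \<in> fsa_states (M x)"
        by (rule run_in_states[OF x(1)]) (use w L_take L_lists in blast)+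
      ultimately have "?\<delta> \<in> \<Delta>" unfolding \<Delta>_def using x(1) by blast
      then have "wd \<one> ?\<delta> \<le> k" by (rule k\<Delta>)
      moreover have "wd (ev (take t w) \<otimes> \<one>) (ev (take t w) \<otimes> ?\<delta>) = wd \<one> ?\<delta>"
        by (rule wd_translate) (use V in auto)
      ultimately show ?thesis using V by (simp flip: m_assoc)
    next
      case False
      have lens: "wd \<one> (ev w) = length w" "wd \<one> (ev w') = length w'" using L_length w by blast+
      have "wd \<one> (ev w) \<le> wd \<one> (ev w') + wd (ev w') (ev w)" "wd (ev w') (ev w) = wd (ev w) (ev w')"
        "wd \<one> (ev w') \<le> wd \<one> (ev w) + wd (ev w) (ev w')"
        using wd_triangle dist_sym V by blast+
      then have close: "length w \<le> length w' + 1" "length w' \<le> length w + 1" using lens near by linarith+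
      have end_near: "wd (ev (take t v)) (ev v) \<le> 1" if "v \<in> L" "length v \<le> t + 1" for v
      proof -
        have vl: "take t v \<in> lists A" "drop t v \<in> lists A"
          using L_lists[OF that(1)] by (auto dest: in_set_takeD in_set_dropD)
        have "ev (take t v) \<otimes> ev (drop t v) = ev (take t v @ drop t v)" using ev_append[OF vl] by (rule sym)
        then have "ev (take t v) \<otimes> ev (drop t v) = ev v" by simp
        from wd_le[OF vl(2) this] show ?thesis using that(2) by simp
      qed
      have "length w \<le> t + 1" "length w' \<le> t + 1" using close False by linarith+
      then have "wd (ev (take t w)) (ev w) \<le> 1" "wd (ev (take t w')) (ev w') \<le> 1"
        using end_near w by blast+
      moreover have "wd (ev (take t w)) (ev (take t w')) \<le> wd (ev (take t w)) (ev w) + wd (ev w) (ev (take t w'))"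
        "wd (ev w) (ev (take t w')) \<le> wd (ev w) (ev w') + wd (ev w') (ev (take t w'))"
        "wd (ev w') (ev (take t w')) = wd (ev (take t w')) (ev w')"
        using wd_triangle dist_sym V by blast+
      ultimately show ?thesis using near k3 by linarith
    qed
  qed
  then show ?thesis by blast
qed

end

section \<open>Tracks from long chains of prefixes\<close>

text \<open>Walk along \<open>q\<close> from time \<open>a\<close>: every value outside \<open>S\<close> is the head of a simple \<open>adj\<close>-chain
  outside \<open>S\<close> that leads back to the starting value or to a neighbour of \<open>S\<close>.\<close>
lemma loop_erasure:
  assumes adj: "\<And>i. a \<le> i \<Longrightarrow> i < b \<Longrightarrow> adj (q (Suc i)) (q i)" and ab: "a \<le> t" "t \<le> b"
  shows "q t \<in> S \<or> (\<exists>xs. xs \<noteq> [] \<and> distinct xs \<and> hd xs = q t \<and> set xs \<subseteq> q ` {a..b} - S \<and>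
     successively adj xs \<and> (last xs = q a \<or> (\<exists>s\<in>{a..b}. q s \<in> S \<and> adj (last xs) (q s))))"
  using ab
proof (induction t rule: dec_induct)
  case base
  show ?case
  proof (cases "q a \<in> S")
    case False
    then show ?thesis using base by (intro disjI2 exI[of _ "[q a]"]) auto
  qed simp
next
  case (step t)
  let ?good = "\<lambda>xs y. xs \<noteq> [] \<and> distinct xs \<and> hd xs = y \<and> set xs \<subseteq> q ` {a..b} - S \<and>
     successively adj xs \<and> (last xs = q a \<or> (\<exists>s\<in>{a..b}. q s \<in> S \<and> adj (last xs) (q s)))"
  show ?case
  proof (cases "q (Suc t) \<in> S")
    case False
    have mem: "q (Suc t) \<in> q ` {a..b} - S" using step False by auto
    have next_adj: "adj (q (Suc t)) (q t)" using adj step by simp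
    have "q t \<in> S \<or> (\<exists>xs. ?good xs (q t))" using step.IH step.prems by simp
    then consider "q t \<in> S" | xs where "?good xs (q t)" by (elim disjE exE)
    then show ?thesis
    proof cases
      case 1
      then have "\<exists>s\<in>{a..b}. q s \<in> S \<and> adj (q (Suc t)) (q s)" using next_adj step
        by (intro bexI[of _ t]) auto
      then have "?good [q (Suc t)] (q (Suc t))" using mem by simp
      then show ?thesis by blast
    next
      case 2
      show ?thesis
      proof (cases "q (Suc t) \<in> set xs")
        case True
        then obtain ys zs where xs: "xs = ys @ q (Suc t) # zs" by (meson split_list)
        have "?good (q (Suc t) # zs) (q (Suc t))"
          using 2 unfolding xs by (auto simp: successively_append_iff)
        then show ?thesis by blast
      next
        case new: False
        have "?good (q (Suc t) # xs) (q (Suc t))"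
          using 2 new mem next_adj by (auto simp: successively_Cons)
        then show ?thesis by blast
      qed
    qed
  qed simp
qed

text \<open>Every element of \<open>S\<close> has a second preimage, which contributes to \<open>Z\<close> in excess of the
  image.\<close>
lemma card_extensions:
  assumes fin: "finite Z" and S: "\<And>x. x \<in> S \<Longrightarrow> \<exists>z\<in>Z. \<exists>z'\<in>Z. f z = x \<and> f z' = x \<and> z \<noteq> z'"
    and sub: "S \<subseteq> f ` Z"
  shows "card (f ` Z) + card S \<le> card Z"
proof -
  have "\<forall>x. \<exists>z. x \<in> f ` Z \<longrightarrow> z \<in> Z \<and> f z = x" by blast
  then obtain g where g: "\<And>x. x \<in> f ` Z \<Longrightarrow> g x \<in> Z \<and> f (g x) = x" by metis
  have "\<forall>x. \<exists>z. x \<in> S \<longrightarrow> z \<in> Z \<and> f z = x \<and> z \<noteq> g x" using S by metis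
  then obtain h where h: "\<And>x. x \<in> S \<Longrightarrow> h x \<in> Z \<and> f (h x) = x \<and> h x \<noteq> g x" by metis
  have "card (g ` f ` Z) = card (f ` Z)" by (rule card_image) (metis g inj_onI)
  moreover have "card (h ` S) = card S" by (rule card_image) (metis h inj_onI)
  moreover have "g ` f ` Z \<inter> h ` S = {}"
  proof (rule ccontr)
    assume "g ` f ` Z \<inter> h ` S \<noteq> {}"
    then obtain x y where xy: "x \<in> f ` Z" "y \<in> S" "g x = h y" by blast
    then have "x = y" using g[OF xy(1)] h[OF xy(2)] by metis
    then show False using xy h[OF xy(2)] by simp
  qed
  moreover have "finite (f ` Z)" "finite S" using fin finite_subset[OF sub] by auto
  ultimately have "card (g ` f ` Z \<union> h ` S) = card (f ` Z) + card S" by (subst card_Un_disjoint) auto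
  moreover have "g ` f ` Z \<union> h ` S \<subseteq> Z" using g h by blast
  ultimately show ?thesis using card_mono[OF fin] by metis
qed

lemma subpath_take: "subpath G w r m = map (\<lambda>t. word_eval G (take t (take m w))) [r..<Suc m]"
  by (auto simp: subpath_def min_def)

context geodesic_automatic_group
begin

text \<open>A common vertex of the subpaths would be represented by a prefix of both words, of length at
  least \<open>r\<close>.\<close>
lemma disjoint_subpaths:
  assumes v: "v \<in> L" "m \<le> length v" and w: "w \<in> L" "m \<le> length w" and ne: "take r v \<noteq> take r w"
  shows "set (subpath G v r m) \<inter> set (subpath G w r m) = {}"
proof (rule ccontr)
  assume "set (subpath G v r m) \<inter> set (subpath G w r m) \<noteq> {}"
  then obtain i j where ij: "r \<le> i" "i \<le> m" "r \<le> j" "j \<le> m" "ev (take i v) = ev (take j w)"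
    by (force simp: subpath_def)
  have "take i v = take j w" using L_inj L_take v(1) w(1) ij(5) by blast
  then have "take r (take i v) = take r (take j w)" by simp
  then show False using ij ne by (simp add: min_def)
qed

text \<open>The two words through the \<open>i\<close>-th prefix of the chain are those that link it to its
  predecessor and to its successor. Since the prefix is unsplit, both label the same path between
  the levels \<open>r\<close> and \<open>r + n\<close>.\<close>
lemma tracks_from_chain:
  assumes n: "0 < n" "length xs = n" "distinct xs" and r: "0 < r"
    and word: "\<And>t. t \<in> I \<Longrightarrow> u t \<in> L \<and> r + n \<le> length (u t)"
    and chain: "successively (\<lambda>x y. \<exists>s\<in>I. \<exists>t\<in>I. take r (u s) = x \<and> take r (u t) = y \<and>
                  wd (ev (u s)) (ev (u t)) \<le> 1) xs"
    and xs: "\<And>x. x \<in> set xs \<Longrightarrow> \<exists>t\<in>I. take r (u t) = x"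
    and unsplit: "\<And>x s t. \<lbrakk>x \<in> set xs; s \<in> I; t \<in> I; take r (u s) = x; take r (u t) = x\<rbrakk> \<Longrightarrow>
                  take (r + n) (u s) = take (r + n) (u t)"
  shows "\<exists>T. n_tracks G A W M n T"
proof -
  have "\<forall>j. \<exists>t. j < n \<longrightarrow> t \<in> I \<and> take r (u t) = xs ! j"
    using xs n(2) nth_mem by metis
  then obtain c where c: "\<And>j. j < n \<Longrightarrow> c j \<in> I \<and> take r (u (c j)) = xs ! j" by metis
  have "\<forall>j. \<exists>s t. Suc j < n \<longrightarrow> s \<in> I \<and> t \<in> I \<and> take r (u s) = xs ! j \<and>
      take r (u t) = xs ! Suc j \<and> wd (ev (u s)) (ev (u t)) \<le> 1"
    using chain n(2) unfolding successively_conv_nth by blast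
  then obtain a b where ab: "\<And>j. Suc j < n \<Longrightarrow> a j \<in> I \<and> b j \<in> I \<and> take r (u (a j)) = xs ! j \<and>
      take r (u (b j)) = xs ! Suc j \<and> wd (ev (u (a j))) (ev (u (b j))) \<le> 1"
    by metis
  define w where "w i = (if i = 1 then c 0 else b (i - 2))" for i :: nat
  define w' where "w' i = (if i = n then c (n - 1) else a (i - 1))" for i :: nat
  have w: "w i \<in> I \<and> take r (u (w i)) = xs ! (i - 1)" if "i \<in> {1..n}" for i
  proof (cases "i = 1")
    case False
    then have "Suc (i - 2) = i - 1" "Suc (i - 2) < n" using that by auto
    then show ?thesis using ab[of "i - 2"] False unfolding w_def by simp
  qed (use c n in \<open>simp add: w_def\<close>)
  have w': "w' i \<in> I \<and> take r (u (w' i)) = xs ! (i - 1)" if "i \<in> {1..n}" for i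
  proof (cases "i = n")
    case False
    then have "Suc (i - 1) < n" using that by auto
    then show ?thesis using ab[of "i - 1"] False unfolding w'_def by simp
  qed (use c n in \<open>simp add: w'_def\<close>)
  have x: "xs ! (i - 1) \<in> set xs" if "i \<in> {1..n}" for i using that n by auto
  define T where "T i = subpath G (u (w i)) r (r + n)" for i
  have T': "T i = subpath G (u (w' i)) r (r + n)" if "i \<in> {1..n}" for i
    using unsplit[OF x[OF that], of "w i" "w' i"] w[OF that] w'[OF that]
    unfolding T_def by (simp add: subpath_take)
  have disj: "set (T i) \<inter> set (T j) = {}" if "i \<in> {1..n}" "j \<in> {1..n}" "i \<noteq> j" for i j
  proof -
    have "i - 1 \<noteq> j - 1" "i - 1 < length xs" "j - 1 < length xs" using that n by auto
    then have "xs ! (i - 1) \<noteq> xs ! (j - 1)" using n(3) by (simp add: nth_eq_iff_index_eq)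
    then show ?thesis
      unfolding T_def using w[OF that(1)] w[OF that(2)] word by (intro disjoint_subpaths) auto
  qed
  have acc: "\<exists>x \<in> A \<union> {\<one>}. accepts_pair A (M x) (u (w' i)) (u (w (i + 1)))" if "i \<in> {1..<n}" for i
  proof -
    have i: "i \<in> {1..n}" "i + 1 \<in> {1..n}" using that by auto
    have e: "w' i = a (i - 1)" "w (i + 1) = b (i - 1)" "Suc (i - 1) < n"
      using that unfolding w'_def w_def by auto
    have L: "u (w' i) \<in> L" "u (w (i + 1)) \<in> L" using w'[OF i(1)] w[OF i(2)] word by blast+
    have "wd (ev (u (w' i))) (ev (u (w (i + 1)))) \<le> 1" using ab[OF e(3)] unfolding e by blast
    then obtain x where "x \<in> A \<union> {\<one>}" "ev (u (w' i)) \<otimes> x = ev (u (w (i + 1)))"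
      using wd_le_1 L_ev L by blast
    then show ?thesis using accepts_iff L L_lists by blast
  qed
  have "n_tracks G A W M n (T ` {1..n})"
    unfolding n_tracks_def
  proof (rule exI[of _ T], rule exI[of _ "\<lambda>i. u (w i)"], rule exI[of _ "\<lambda>i. u (w' i)"],
      rule exI[of _ r], intro conjI ballI impI refl)
    show "set (T i) \<inter> set (T j) = {}" if "i \<in> {1..n}" "j \<in> {1..n}" "i \<noteq> j" for i j
      by (rule disj[OF that])
    show "T i = subpath G (u (w i)) r (r + n)" for i by (rule T_def)
    show "T i = subpath G (u (w' i)) r (r + n)" if "i \<in> {1..n}" for i by (rule T'[OF that])
    show "\<exists>x\<in>A \<union> {\<one>}. accepts_pair A (M x) (u (w' i)) (u (w (i + 1)))" if "i \<in> {1..<n}" for i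
      by (rule acc[OF that])
  qed (use r w w' word in auto)
  then show ?thesis by blast
qed

lemma chain_distance:
  assumes "xs \<noteq> []" "\<And>x. x \<in> set xs \<Longrightarrow> x \<in> L" "successively adj xs"
    and "\<And>x y. x \<in> L \<Longrightarrow> y \<in> L \<Longrightarrow> adj x y \<Longrightarrow> wd (ev x) (ev y) \<le> k"
  shows "wd (ev (hd xs)) (ev (last xs)) + k \<le> k * length xs"
  using assms(1-3)
proof (induction xs rule: induct_list012)
  case (2 x)
  then show ?case using wd_refl L_ev by simp
next
  case (3 x y zs)
  then have V: "x \<in> L" "y \<in> L" "last (y # zs) \<in> L" by auto
  have "wd (ev y) (ev (last (y # zs))) + k \<le> k * length (y # zs)" using 3 by simp
  moreover have "wd (ev x) (ev y) \<le> k" using assms(4) V 3 by simp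
  moreover have "wd (ev x) (ev (last (y # zs))) \<le> wd (ev x) (ev y) + wd (ev y) (ev (last (y # zs)))"
    using wd_triangle L_ev V by blast
  ultimately show ?case by simp
qed simp

text \<open>The number of prefixes at any level is bounded if there are no tracks. Here \<open>S\<close> is the set of
  split prefixes among those of the words that reach level \<open>r + n\<close>. If \<open>S\<close> has fewer than \<open>n\<close>
  elements, then loop erasure gives every other prefix a simple chain of unsplit prefixes leading
  towards \<open>S\<close> or the starting prefix. Such a chain has fewer than \<open>n\<close> elements because there are no
  tracks, so all prefixes lie in at most \<open>n\<close> balls of radius \<open>k * n\<close>.\<close>
lemma few_prefixes_if_no_tracks:
  assumes n: "0 < n" and no_tracks: "\<nexists>T. n_tracks G A W M n T"
    and k: "\<And>w w' t. \<lbrakk>w \<in> L; w' \<in> L; wd (ev w) (ev w') \<le> 1\<rbrakk> \<Longrightarrow> wd (ev (take t w)) (ev (take t w')) \<le> k"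
    and B: "\<And>g. g \<in> carrier G \<Longrightarrow> finite {h \<in> carrier G. wd g h \<le> k * n} \<and> card {h \<in> carrier G. wd g h \<le> k * n} \<le> B"
    and u: "\<And>t. t \<le> N \<Longrightarrow> u t \<in> L \<and> length (u t) = t"
    and near: "\<And>t. t < N \<Longrightarrow> wd (ev (u t)) (ev (u (Suc t))) \<le> 1"
  shows "card ((\<lambda>t. take r (u t)) ` {r..N}) \<le> n * B + n"
proof -
  define D where "D r = card ((\<lambda>t. take r (u t)) ` {r..N})" for r
  have step: "D r \<le> D (r + n)" if big: "n * B + n < D r" for r
  proof -
    define p where "p t = take r (u t)" for t
    define I where "I = {r + n..N}"
    define P where "P = p ` I"
    define Z where "Z = (\<lambda>t. take (r + n) (u t)) ` I"
    have Dr: "D r = card (p ` {r..N})" unfolding D_def p_def ..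
    have "{r..N} \<subseteq> I \<union> {r..<r + n}" unfolding I_def by auto
    then have "p ` {r..N} \<subseteq> P \<union> p ` {r..<r + n}" unfolding P_def by blast
    then have "D r \<le> card (P \<union> p ` {r..<r + n})" unfolding Dr P_def I_def by (intro card_mono) auto
    also have "\<dots> \<le> card P + card (p ` {r..<r + n})" by (rule card_Un_le)
    also have "card (p ` {r..<r + n}) \<le> n" using card_image_le[of "{r..<r + n}" p] by simp
    finally have DP: "D r \<le> card P + n" by simp
    then have PB: "n * B < card P" using big by simp
    then have "P \<noteq> {}" by auto
    then have rN: "r + n \<le> N" unfolding P_def I_def by auto
    have r0: "0 < r"
    proof (rule ccontr)
      assume "\<not> 0 < r"
      then have sub: "p ` {r..N} \<subseteq> {[]}" unfolding p_def by auto
      have "D r \<le> 1" unfolding Dr using card_mono[OF _ sub] by simp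
      then show False using big n by simp
    qed
    have uI: "u t \<in> L" "length (u t) = t" if "t \<in> I" for t using u that unfolding I_def by auto
    have pL: "p t \<in> L" if "t \<in> I" for t using uI[OF that] L_take unfolding p_def by blast
    have PZ: "P = take r ` Z" unfolding P_def Z_def p_def image_image by (simp add: min_def)
    define S where "S = {x \<in> P. \<exists>z\<in>Z. \<exists>z'\<in>Z. take r z = x \<and> take r z' = x \<and> z \<noteq> z'}"
    have SP: "S \<subseteq> P" unfolding S_def by blast
    have finP: "finite P" unfolding P_def I_def by simp
    have "card (take r ` Z) + card S \<le> card Z"
    proof (rule card_extensions)
      show "finite Z" unfolding Z_def I_def by simp
      show "\<exists>z\<in>Z. \<exists>z'\<in>Z. take r z = x \<and> take r z' = x \<and> z \<noteq> z'" if "x \<in> S" for x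
        using that unfolding S_def mem_Collect_eq by (elim conjE)
      show "S \<subseteq> take r ` Z" using SP PZ by simp
    qed
    then have "card P + card S \<le> card Z" using PZ by simp
    moreover have "card Z = D (r + n)" unfolding Z_def D_def I_def ..
    moreover have "n \<le> card S"
    proof (rule ccontr)
      assume "\<not> n \<le> card S"
      then have few: "Suc (card S) \<le> n" by simp
      \<comment> \<open>This relation is symmetric, so the direction of a chain does not matter.\<close>
      define adj where "adj x y \<longleftrightarrow> (\<exists>s\<in>I. \<exists>t\<in>I. p s = x \<and> p t = y \<and> wd (ev (u s)) (ev (u t)) \<le> 1)" for x y
      have adj_k: "wd (ev x) (ev y) \<le> k" if "adj x y" for x y
        using that k uI unfolding adj_def p_def by blast
      have adj_step: "adj (p (Suc t)) (p t)" if "r + n \<le> t" "t < N" for t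
      proof -
        have "wd (ev (u (Suc t))) (ev (u t)) = wd (ev (u t)) (ev (u (Suc t)))"
          using dist_sym L_ev u that by simp
        then have "wd (ev (u (Suc t))) (ev (u t)) \<le> 1" using near that by simp
        then show ?thesis unfolding adj_def I_def using that by (intro bexI[of _ "Suc t"] bexI[of _ t]) auto
      qed
      have close: "\<exists>c \<in> insert (p (r + n)) S. wd (ev c) (ev x) \<le> k * n" if xP: "x \<in> P" for x
      proof (cases "x \<in> S")
        case True
        then show ?thesis using SP P_def pL wd_refl L_ev by (intro bexI[of _ x]) auto
      next
        case False
        obtain t where t: "r + n \<le> t" "t \<le> N" "x = p t"
          using xP unfolding P_def I_def by auto
        have "p t \<in> S \<or> (\<exists>xs. xs \<noteq> [] \<and> distinct xs \<and> hd xs = p t \<and> set xs \<subseteq> p ` {r + n..N} - S \<and>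
          successively adj xs \<and> (last xs = p (r + n) \<or> (\<exists>s\<in>{r + n..N}. p s \<in> S \<and> adj (last xs) (p s))))"
          by (rule loop_erasure[of "r + n" N adj p]) (use adj_step t in auto)
        then obtain xs where xs: "xs \<noteq> []" "distinct xs" "hd xs = x" "set xs \<subseteq> P - S"
          "successively adj xs" "last xs = p (r + n) \<or> (\<exists>c\<in>S. adj (last xs) c)"
          using False t unfolding P_def I_def by blast
        have xsL: "y \<in> L" if "y \<in> set xs" for y using that xs(4) pL unfolding P_def by blast
        have short: "length xs < n"
        proof (rule ccontr)
          assume "\<not> length xs < n"
          define ys where "ys = take n xs"
          have sub: "set ys \<subseteq> set xs" unfolding ys_def by (rule set_take_subset)
          have split: "xs = ys @ drop n xs" unfolding ys_def by simp
          have "\<exists>T. n_tracks G A W M n T"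
          proof (rule tracks_from_chain[OF n _ _ r0, of ys I u])
            show "length ys = n" unfolding ys_def using \<open>\<not> length xs < n\<close> by simp
            show "distinct ys" unfolding ys_def using xs(2) by simp
            show "u t \<in> L \<and> r + n \<le> length (u t)" if "t \<in> I" for t
              using uI[OF that] that unfolding I_def by simp
            have "successively adj ys" using xs(5) split successively_append_iff by metis
            then show "successively (\<lambda>x y. \<exists>s\<in>I. \<exists>t\<in>I. take r (u s) = x \<and> take r (u t) = y \<and>
                wd (ev (u s)) (ev (u t)) \<le> 1) ys"
              unfolding adj_def p_def .
            show "\<exists>t\<in>I. take r (u t) = y" if "y \<in> set ys" for y
              using that sub xs(4) unfolding P_def p_def by blast
            show "take (r + n) (u s) = take (r + n) (u t)"
              if y: "y \<in> set ys" and st: "s \<in> I" "t \<in> I" "take r (u s) = y" "take r (u t) = y" for y s t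
            proof (rule ccontr)
              assume "take (r + n) (u s) \<noteq> take (r + n) (u t)"
              moreover have "take (r + n) (u s) \<in> Z" "take (r + n) (u t) \<in> Z" using st Z_def by auto
              moreover have "take r (take (r + n) (u s)) = y" "take r (take (r + n) (u t)) = y"
                using st by (simp_all add: min_def)
              moreover have "y \<in> P" using y sub xs(4) by blast
              ultimately have "y \<in> S" unfolding S_def by blast
              then show False using y sub xs(4) by blast
            qed
          qed
          then show False using no_tracks by blast
        qed
        have cd: "wd (ev x) (ev (last xs)) + k \<le> k * length xs"
          using chain_distance[OF xs(1) xsL xs(5), of k] adj_k xs(3) by simp
        have "k * (length xs + 1) \<le> k * n" using short by (intro mult_le_mono2) simp
        then have kn: "wd (ev x) (ev (last xs)) + k \<le> k * n" using cd by simp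
        have lL: "last xs \<in> L" "x \<in> L" using xsL xs(1,3) by auto
        from xs(6) show ?thesis
        proof
          assume l: "last xs = p (r + n)"
          have "wd (ev (last xs)) (ev x) = wd (ev x) (ev (last xs))" using dist_sym L_ev lL by blast
          then show ?thesis using kn l by (intro bexI[of _ "p (r + n)"]) auto
        next
          assume "\<exists>c\<in>S. adj (last xs) c"
          then obtain c where c: "c \<in> S" "adj (last xs) c" by blast
          have cL: "c \<in> L" using c(1) SP pL unfolding P_def by blast
          have "wd (ev x) (ev c) \<le> wd (ev x) (ev (last xs)) + wd (ev (last xs)) (ev c)"
            using wd_triangle L_ev lL cL by blast
          then have "wd (ev x) (ev c) \<le> k * n" using adj_k[OF c(2)] kn by linarith
          moreover have "wd (ev c) (ev x) = wd (ev x) (ev c)" using dist_sym L_ev lL cL by blast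
          ultimately show ?thesis using c(1) by (intro bexI[of _ c]) auto
        qed
      qed
      define C where "C = insert (p (r + n)) S"
      have "r + n \<in> I" unfolding I_def using rN by simp
      then have CL: "c \<in> L" if "c \<in> C" for c using that SP pL unfolding C_def P_def by blast
      have finC: "finite C" unfolding C_def using finP SP finite_subset by auto
      have evP: "ev ` P \<subseteq> (\<Union>c\<in>C. {h \<in> carrier G. wd (ev c) h \<le> k * n})"
        using close pL L_ev unfolding C_def P_def by blast
      have "card P = card (ev ` P)"
        by (rule card_image[symmetric]) (use L_inj pL in \<open>auto simp: inj_on_def P_def\<close>)
      also have "\<dots> \<le> card (\<Union>c\<in>C. {h \<in> carrier G. wd (ev c) h \<le> k * n})"
        by (rule card_mono[OF _ evP]) (use finC B CL L_ev in auto)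
      also have "\<dots> \<le> (\<Sum>c\<in>C. card {h \<in> carrier G. wd (ev c) h \<le> k * n})"
        by (rule card_UN_le[OF finC])
      also have "\<dots> \<le> (\<Sum>c\<in>C. B)" by (rule sum_mono) (use B CL L_ev in auto)
      also have "\<dots> = card C * B" by simp
      also have "\<dots> \<le> n * B"
      proof (rule mult_le_mono1)
        have "card C \<le> Suc (card S)" unfolding C_def by (rule card_insert_le_m1) auto
        then show "card C \<le> n" using few by simp
      qed
      finally show False using PB by simp
    qed
    ultimately show ?thesis using DP by linarith
  qed
  show ?thesis
  proof (rule ccontr)
    assume "\<not> ?thesis"
    then have big: "n * B + n < D r" unfolding D_def by simp
    have "D r \<le> D (r + j * n)" for j
    proof (induction j)
      case (Suc j)
      then show ?case using step[of "r + j * n"] big by (simp add: algebra_simps)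
    qed simp
    from this[of "Suc N"] have "D r \<le> D (r + Suc N * n)" .
    moreover have "N < r + Suc N * n" using n by (cases n) auto
    then have "D (r + Suc N * n) = 0" unfolding D_def by simp
    ultimately show False using big by simp
  qed
qed

text \<open>At level \<open>s\<close> the prefixes of the accepted words for the points of \<open>f\<close> after time \<open>s\<close> lead in
  bounded steps from \<open>f s\<close> to the prefix of \<open>nf g\<close>, and there are boundedly many of them.\<close>
lemma geodesic_near_normal_form:
  assumes n: "0 < n" and no_tracks: "\<nexists>T. n_tracks G A W M n T"
  shows "\<exists>C. \<forall>f g t. geod f \<one> g \<longrightarrow> wd (f t) (ev (take t (nf g))) \<le> C"
proof -
  obtain k where k: "\<And>w w' t. \<lbrakk>w \<in> L; w' \<in> L; wd (ev w) (ev w') \<le> 1\<rbrakk> \<Longrightarrow>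
      wd (ev (take t w)) (ev (take t w')) \<le> k"
    using fellow_traveller by blast
  obtain B where B: "\<And>g. g \<in> carrier G \<Longrightarrow>
      finite {h \<in> carrier G. wd g h \<le> k * n} \<and> card {h \<in> carrier G. wd g h \<le> k * n} \<le> B"
    using ball_card_bound by blast
  define C where "C = n * B + n"
  have "wd (f s) (ev (take s (nf g))) \<le> k * C" if f: "geod f \<one> g" for f g s
  proof -
    define N where "N = wd \<one> g"
    define u where "u t = nf (f t)" for t
    have V: "\<And>t. f t \<in> carrier G" "g \<in> carrier G" using geod_in geod_ends_in f by blast+
    have uL: "u t \<in> L" and ev_u: "ev (u t) = f t" for t
      unfolding u_def using nf_L ev_nf V by blast+
    have len: "length (u t) = t" if "t \<le> N" for t
      using nf_length[OF V(1)] geod_dist_start[OF f] that unfolding u_def N_def by simp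
    have uN: "u t = nf g" if "N \<le> t" for t
      using geod_end[OF f] that unfolding u_def N_def by simp
    have near: "wd (ev (u t)) (ev (u (Suc t))) \<le> 1" for t
      using geod_lipschitz[OF f, of t "Suc t"] ev_u by simp
    show ?thesis
    proof (cases "s \<le> N")
      case False
      then have "take s (nf g) = nf g" "f s = g"
        using nf_length[OF V(2)] geod_end[OF f] unfolding N_def by simp_all
      then show ?thesis using wd_refl V ev_nf by simp
    next
      case True
      define p where "p t = take s (u t)" for t
      have pL: "p t \<in> L" for t unfolding p_def using uL L_take by blast
      have card: "card (p ` {s..N}) \<le> C"
        unfolding p_def C_def by (rule few_prefixes_if_no_tracks[OF n no_tracks k B]) (use uL len near in auto)
      define adj where "adj x y \<longleftrightarrow> wd (ev x) (ev y) \<le> k" for x y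
      have "adj (p (Suc t)) (p t)" for t
      proof -
        have "wd (ev (p t)) (ev (p (Suc t))) \<le> k" unfolding p_def by (rule k[OF uL uL near])
        then show ?thesis unfolding adj_def using dist_sym L_ev pL by simp
      qed
      then have "p N \<in> {} \<or> (\<exists>xs. xs \<noteq> [] \<and> distinct xs \<and> hd xs = p N \<and> set xs \<subseteq> p ` {s..N} - {} \<and>
          successively adj xs \<and> (last xs = p s \<or> (\<exists>i\<in>{s..N}. p i \<in> {} \<and> adj (last xs) (p i))))"
        using True by (intro loop_erasure) auto
      then obtain xs where xs: "xs \<noteq> []" "distinct xs" "hd xs = p N" "set xs \<subseteq> p ` {s..N}"
        "successively adj xs" "last xs = p s"
        by auto
      have "length xs = card (set xs)" using distinct_card[OF xs(2)] by simp
      also have "\<dots> \<le> C" using card_mono[OF _ xs(4)] card by simp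
      finally have "k * length xs \<le> k * C" by (rule mult_le_mono2)
      moreover have "wd (ev (hd xs)) (ev (last xs)) + k \<le> k * length xs"
        by (rule chain_distance[OF xs(1) _ xs(5)]) (use xs(4) pL adj_def in auto)
      ultimately have "wd (ev (p N)) (ev (p s)) \<le> k * C" unfolding xs(3,6) by linarith
      moreover have "p s = u s" "p N = take s (nf g)" unfolding p_def using len[OF True] uN by simp_all
      ultimately show ?thesis using dist_sym L_ev pL ev_u by metis
    qed
  qed
  then show ?thesis by blast
qed

lemma hyperbolic_if_no_tracks:
  assumes n: "0 < n" and no_tracks: "\<nexists>T. n_tracks G A W M n T"
  shows "word_hyperbolic G A"
proof -
  obtain k where k: "\<And>w w' t. \<lbrakk>w \<in> L; w' \<in> L; wd (ev w) (ev w') \<le> 1\<rbrakk> \<Longrightarrow>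
      wd (ev (take t w)) (ev (take t w')) \<le> k"
    using fellow_traveller by blast
  obtain C where C: "\<And>f g t. geod f \<one> g \<Longrightarrow> wd (f t) (ev (take t (nf g))) \<le> C"
    using geodesic_near_normal_form[OF assms] by blast
  interpret thin_bigons "carrier G" wd "Suc (2 * C + k)"
  proof
    fix f g x y z t assume f: "geod f x y" and g: "geod g x z" and yz: "wd y z \<le> 1"
    have V: "x \<in> carrier G" "y \<in> carrier G" "z \<in> carrier G" "f t \<in> carrier G" "g t \<in> carrier G"
      using geod_in geod_ends_in f g by blast+
    define c where "c = inv x"
    have c: "c \<in> carrier G" "c \<otimes> x = \<one>" unfolding c_def using V by simp_all
    have cV: "c \<otimes> y \<in> carrier G" "c \<otimes> z \<in> carrier G" "c \<otimes> f t \<in> carrier G" "c \<otimes> g t \<in> carrier G"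
      using c V by simp_all
    define p where "p = ev (take t (nf (c \<otimes> y)))"
    define q where "q = ev (take t (nf (c \<otimes> z)))"
    have pq: "p \<in> carrier G" "q \<in> carrier G" unfolding p_def q_def using L_ev L_take nf_L cV by blast+
    have "geod (\<lambda>i. c \<otimes> f i) \<one> (c \<otimes> y)" "geod (\<lambda>i. c \<otimes> g i) \<one> (c \<otimes> z)"
      using geod_translate[OF f c(1)] geod_translate[OF g c(1)] c(2) by simp_all
    then have 1: "wd (c \<otimes> f t) p \<le> C" "wd (c \<otimes> g t) q \<le> C" unfolding p_def q_def using C by blast+
    have "wd (c \<otimes> y) (c \<otimes> z) \<le> 1" using wd_translate c V yz by simp
    then have 2: "wd p q \<le> k" unfolding p_def q_def using k nf_L ev_nf cV by simp
    have "wd (c \<otimes> f t) (c \<otimes> g t) \<le> wd (c \<otimes> f t) p + wd p (c \<otimes> g t)"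
      "wd p (c \<otimes> g t) \<le> wd p q + wd q (c \<otimes> g t)" "wd q (c \<otimes> g t) = wd (c \<otimes> g t) q"
      using wd_triangle dist_sym cV pq by blast+
    then have "wd (c \<otimes> f t) (c \<otimes> g t) \<le> Suc (2 * C + k)" using 1 2 by linarith
    then show "wd (f t) (g t) \<le> Suc (2 * C + k)" using wd_translate c V by simp
  qed simp
  show ?thesis
    unfolding word_hyperbolic_def
    by (rule gromov_hyperbolic_if_roughly_isometric[of _ base_vertex])
      (auto simp: cayley_points_def intro: cayley_dist_rough)
qed

end

theorem theorem3p2:
  fixes G :: "('a, 'm) monoid_scheme"
    and A :: "'a set"
    and W :: "('p, 'a) fsa"
    and M :: "'a \<Rightarrow> ('q, 'a option \<times> 'a option) fsa"
  assumes "group G"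
    and "A \<subseteq> carrier G" and "finite A"
    and "generate G A = carrier G"
    and "m_inv G ` A = A"
    and "automatic_structure G A W M"
    and "weakly_geodesic G A (fsa_lang A W)"
    and "prefix_closed (fsa_lang A W)"
    and "uniqueness_property G (fsa_lang A W)"
    and "\<not> word_hyperbolic G A"
  shows "\<forall>n::nat. n > 0 \<longrightarrow> (\<exists>T. n_tracks G A W M n T)"
proof -
  interpret group G by fact
  interpret geodesic_automatic_group G A W M
  proof
    have "word_eval G ` fsa_lang A W = carrier G" "fsa_lang A W \<subseteq> lists A"
      using assms(6) by (auto simp: automatic_structure_def fsa_lang_def)
    then show "carrier G \<subseteq> word_eval G ` lists A" by blast
  qed (use assms in auto)
  show ?thesis using hyperbolic_if_no_tracks assms(10) by blast
qed

end
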